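(* There exists $C > 0$ such that for all primes $\ell$, for all $Z > 0$ and for all squarefree integers $d < -1$ with $|\pi_d(Z)| > 0$, $$|\mathrm{Cl}_d[\ell]| \leq \frac{C |d|^{1/2} \log |d|}{|\pi_d(Z)|} + \frac{C |d|^{1/2} \log |d|}{|\pi_d(Z)|^2} \cdot |S_\ell(d, Z)|.$$
   Context: For squarefree $d<-1$, let $K=\mathbb{Q}(\sqrt{d})$, $O_d$ its ring of integers, $\mathrm{Cl}_d$ its ideal class group and $\mathrm{Cl}_d[\ell]$ its $\ell$-torsion subgroup. Let $\pi_d(Z)$ be the set of prime ideals $\mathfrak{p}$ of $O_d$ with ramification index $1$ and residue field degree $1$ over $\mathbb{Q}$ and with $N_{K/\mathbb{Q}}(\mathfrak{p}) \leq Z$. Define $$S_\ell(d, Z) := \left\{u + v \sqrt{d} \in O_d,\ u \neq 0,\ v \neq 0 : (p_1p_2)^\ell = u^2 - dv^2 \text{ for some primes } p_1, p_2 \leq Z\right\}$$ (with $u, v \in \mathbb{Q}$). *)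

theory Defs
  imports
    "HOL-Computational_Algebra.Polynomial"
    "HOL-Computational_Algebra.Squarefree"
    "HOL-Algebra.QuotRing"
    "HOL-Algebra.Ideal_Product"
    "HOL-Algebra.Embedded_Algebras"
begin

text \<open>
  \<open>\<rat>(\<surd>d)\<close> is realised inside the complex numbers, with \<open>\<surd>d = csqrt d\<close>.
\<close>

definition quad_field :: "int \<Rightarrow> complex ring" where
  "quad_field d =
     \<lparr>carrier = {of_rat u + of_rat v * csqrt (of_int d) | u v. True},
      mult = (*), one = 1, zero = 0, add = (+)\<rparr>"

definition quad_integers :: "int \<Rightarrow> complex ring" where
  "quad_integers d =
     (quad_field d)\<lparr>carrier := {x \<in> carrier (quad_field d). algebraic_int x}\<rparr>"

definition fractional_ideal :: "int \<Rightarrow> complex set \<Rightarrow> bool" where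
  "fractional_ideal d J \<longleftrightarrow>
     additive_subgroup J (quad_field d) \<and>
     (\<forall>a\<in>carrier (quad_integers d). \<forall>x\<in>J. a * x \<in> J) \<and>
     J \<noteq> {0} \<and>
     (\<exists>a\<in>carrier (quad_integers d). a \<noteq> 0 \<and> (\<forall>x\<in>J. a * x \<in> carrier (quad_integers d)))"

text \<open>
  \<^const>\<open>ideal_prod\<close> over the field consists of the finite sums of products \<open>x y\<close> with
  \<open>x \<in> I\<close>, \<open>y \<in> J\<close>, which is the product of fractional ideals.
\<close>

definition fractional_ideal_group :: "int \<Rightarrow> complex set monoid" where
  "fractional_ideal_group d =
     \<lparr>carrier = {J. fractional_ideal d J},
      mult = ideal_prod (quad_field d),
      one = carrier (quad_integers d)\<rparr>"

definition principal_fractional_ideals :: "int \<Rightarrow> complex set set" where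
  "principal_fractional_ideals d =
     {(\<lambda>x. a * x) ` carrier (quad_integers d) | a. a \<in> carrier (quad_field d) \<and> a \<noteq> 0}"

definition class_group :: "int \<Rightarrow> complex set set monoid" where
  "class_group d = fractional_ideal_group d Mod principal_fractional_ideals d"

definition class_group_torsion :: "nat \<Rightarrow> int \<Rightarrow> complex set set set" where
  "class_group_torsion l d =
     {c \<in> carrier (class_group d). c [^]\<^bsub>class_group d\<^esub> l = \<one>\<^bsub>class_group d\<^esub>}"

definition ideal_norm :: "int \<Rightarrow> complex set \<Rightarrow> nat" where
  "ideal_norm d I = card (carrier (quad_integers d Quot I))"

text \<open>
  The following three notions are meaningful for nonzero prime ideals \<open>P\<close> only.
\<close>

definition prime_below :: "complex set \<Rightarrow> nat" where
  "prime_below P = (THE p. Factorial_Ring.prime p \<and> of_nat p \<in> P)"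

definition ramification_index :: "int \<Rightarrow> complex set \<Rightarrow> nat" where
  "ramification_index d P =
     (GREATEST e. \<exists>J. ideal J (quad_integers d) \<and>
        PIdl\<^bsub>quad_integers d\<^esub> (of_nat (prime_below P)) =
          (P [^]\<^bsub>ideals_set (quad_integers d)\<^esub> e) \<cdot>\<^bsub>quad_integers d\<^esub> J)"

text \<open>
  The dimension of the residue field over its prime field, the image of \<open>\<int>\<close>.
\<close>

definition residue_degree :: "int \<Rightarrow> complex set \<Rightarrow> nat" where
  "residue_degree d P =
     (THE f. ring.dimension (quad_integers d Quot P) f
        (range (\<lambda>k::int. P +>\<^bsub>quad_integers d\<^esub> of_int k))
        (carrier (quad_integers d Quot P)))"

definition degree_one_primes :: "int \<Rightarrow> real \<Rightarrow> complex set set" where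
  "degree_one_primes d Z =
     {P. primeideal P (quad_integers d) \<and> P \<noteq> {0} \<and>
         ramification_index d P = 1 \<and> residue_degree d P = 1 \<and>
         real (ideal_norm d P) \<le> Z}"

definition S_set :: "nat \<Rightarrow> int \<Rightarrow> real \<Rightarrow> complex set" where
  "S_set l d Z =
     {of_rat u + of_rat v * csqrt (of_int d) | u v.
        of_rat u + of_rat v * csqrt (of_int d) \<in> carrier (quad_integers d) \<and>
        u \<noteq> 0 \<and> v \<noteq> 0 \<and>
        (\<exists>p1 p2 :: nat. Factorial_Ring.prime p1 \<and> Factorial_Ring.prime p2 \<and>
           real p1 \<le> Z \<and> real p2 \<le> Z \<and>
           (of_nat p1 * of_nat p2) ^ l = u\<^sup>2 - of_int d * v\<^sup>2)}"

end

theory Submission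
  imports Defs
begin

text \<open>
  Write \<open>h\<close> for the class number.  Among the degree-one primes of norm at most \<open>Z\<close>, count the
  pairs \<open>(P, Q)\<close> whose classes have the same \<open>l\<close>-th power.  The \<open>l\<close>-th powers form a set of
  \<open>h / |Cl[l]|\<close> classes, so by Cauchy--Schwarz there are at least \<open>|\<pi>|\<^sup>2 |Cl[l]| / h\<close> such pairs.
  For an off-diagonal pair, \<open>(P Q')\<^sup>l\<close> (with \<open>Q'\<close> the conjugate of \<open>Q\<close>) is principal, and a
  generator lies in \<open>S\<close>: its coordinates do not vanish because \<open>P\<close> and \<open>Q\<close> are unramified and
  distinct.  The ideal \<open>(P Q')\<^sup>l\<close> determines \<open>{P, Q'}\<close>, so there are at most \<open>|\<pi>| + 2 |S|\<close> pairs.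

  For \<open>h\<close>, every class contains an ideal \<open>\<int> a + \<int> (b + \<omega>)\<close> with \<open>0 \<le> b < a \<le> 2 |d|\<^sup>1\<^sup>/\<^sup>2\<close> and
  \<open>a\<close> dividing the norm of \<open>b + \<omega>\<close>.  Since that norm form has no double roots, the number of
  admissible \<open>b\<close> is at most the number of divisors of \<open>a\<close>, and summing over \<open>a\<close> gives
  \<open>O(|d|\<^sup>1\<^sup>/\<^sup>2 log |d|)\<close>.
\<close>

subsection \<open>The ring of integers\<close>

text \<open>Unique factorisation of ideals is never invoked. Dividing by a shortest vector shows
  every fractional ideal to be a multiple of an explicit lattice \<open>quad_ideal a b\<close>. That
  lattice times its conjugate is \<open>a\<close> times the ring of integers, so one normal form
  yields inverses (hence the class group) as well as the finite list of representatives behind the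
  class number bound. Primality of split ideals is read off the ring homomorphism to the integers
  modulo \<open>p\<close> that sends \<open>\<omega>\<close> to \<open>- b\<close>.

  The conjugate of Q stands in for its inverse because Q Q' is principal; it also keeps P Q'
  integral, so that a generator is an algebraic integer. If a coordinate of the generator vanished,
  the generator would be its own conjugate up to sign, and P would contain its own conjugate or Q.

  A preliminary obstacle: the ring of integers is given by algebraic integrality, so the basis
  \<open>1\<close>, \<open>\<omega>\<close> must be recovered from bounded denominators before
  anything can be computed.\<close>

lemma rat_int_if_powers_bounded_denominator:
  fixes r :: rat and D :: int
  assumes "D > 0" and int: "\<And>k. of_int D * r ^ k \<in> \<int>"
  shows "r \<in> \<int>"
proof -
  obtain a b where ab: "quotient_of r = (a, b)" by force
  have b: "b > 0" and cop: "coprime a b" and r: "r = of_int a / of_int b"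
    using quotient_of_denom_pos[OF ab] quotient_of_coprime[OF ab] quotient_of_div[OF ab] by auto
  have dvd: "b ^ k dvd D" for k
  proof -
    obtain m where "of_int D * r ^ k = of_int m" using int[of k] by (auto elim: Ints_cases)
    hence "(of_int (D * a ^ k) :: rat) = of_int (m * b ^ k)"
      using b by (simp add: r power_divide field_simps)
    hence "D * a ^ k = m * b ^ k" by (simp only: of_int_eq_iff)
    hence "b ^ k dvd D * a ^ k" by simp
    moreover have "coprime (b ^ k) (a ^ k)" using cop by (simp add: coprime_commute)
    ultimately show ?thesis using coprime_dvd_mult_left_iff by blast
  qed
  have "b = 1"
  proof (rule ccontr)
    assume "b \<noteq> 1"
    hence "b \<ge> 2" using b by simp
    \<comment> \<open>The exponent \<open>D\<close> itself suffices: \<open>b ^ D\<close> divides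
      \<open>D\<close>, yet is at least \<open>2 ^ D\<close>.\<close>
    have "int (nat D) < 2 ^ nat D" by (rule of_nat_less_two_power)
    also have "(2::int) ^ nat D \<le> b ^ nat D" using \<open>b \<ge> 2\<close> by (intro power_mono) auto
    also have "\<dots> \<le> D" using dvd assms(1) by (intro zdvd_imp_le) auto
    finally show False using assms(1) by simp
  qed
  thus ?thesis by (simp add: r)
qed

text \<open>In lowest terms the square of the denominator divides \<open>d\<close>. This is where
  squarefreeness makes the doubled irrational coordinate of an algebraic integer an integer.\<close>

lemma squarefree_mult_square_int:
  fixes r :: rat and d :: int
  assumes "squarefree d" and "of_int d * r\<^sup>2 \<in> \<int>"
  shows "r \<in> \<int>"
proof -
  obtain a b where ab: "quotient_of r = (a, b)" by force
  have b: "b > 0" and cop: "coprime a b" and r: "r = of_int a / of_int b"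
    using quotient_of_denom_pos[OF ab] quotient_of_coprime[OF ab] quotient_of_div[OF ab] by auto
  obtain m where "of_int d * r\<^sup>2 = of_int m" using assms(2) by (auto elim: Ints_cases)
  hence "(of_int (d * a\<^sup>2) :: rat) = of_int (m * b\<^sup>2)"
    using b by (simp add: r power_divide field_simps)
  hence "d * a\<^sup>2 = m * b\<^sup>2" by (simp only: of_int_eq_iff)
  hence "b\<^sup>2 dvd d * a\<^sup>2" by simp
  moreover have "coprime (b\<^sup>2) (a\<^sup>2)" using cop by (simp add: coprime_commute)
  ultimately have "b\<^sup>2 dvd d" using coprime_dvd_mult_left_iff by blast
  hence "b dvd 1" using assms(1) by (simp add: squarefree_def)
  thus ?thesis using b by (simp add: r)
qed

lemma of_rat_complex: "(of_rat u :: complex) = of_real (of_rat u)"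
proof -
  obtain a b where "quotient_of u = (a, b)" by force
  hence "u = of_int a / of_int b" by (rule quotient_of_div)
  thus ?thesis by (simp add: of_rat_divide)
qed

lemma Im_of_rat [simp]: "Im (of_rat u) = 0"
  and Re_of_rat [simp]: "Re (of_rat u) = of_rat u"
  and cnj_of_rat [simp]: "cnj (of_rat u) = of_rat u"
  by (simp_all add: of_rat_complex)

lemma of_rat_Ints_iff: "(of_rat r :: 'a :: field_char_0) \<in> \<int> \<longleftrightarrow> r \<in> \<int>"
proof
  assume "(of_rat r :: 'a) \<in> \<int>"
  then obtain m where "(of_rat r :: 'a) = of_int m" by (auto elim: Ints_cases)
  hence "(of_rat r :: 'a) = of_rat (of_int m)" by simp
  hence "r = of_int m" by (simp only: of_rat_eq_iff)
  thus "r \<in> \<int>" by simp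
qed (auto elim!: Ints_cases)

locale imag_quad =
  fixes d :: int
  assumes sqf: "squarefree d" and dneg: "d < -1"
begin

abbreviation "K \<equiv> carrier (quad_field d)"
abbreviation "Od \<equiv> carrier (quad_integers d)"

text \<open>\<open>\<omega>\<close> is the standard second basis element of the ring of integers, \<open>tr_w\<close> and \<open>nm_w\<close> are its
  trace and norm, and \<open>wnorm b\<close> is the norm of \<open>b + \<omega>\<close>.\<close>

definition rt :: complex where "rt = csqrt (of_int d)"
definition tr_w :: int where "tr_w = (if d mod 4 = 1 then 1 else 0)"
definition nm_w :: int where "nm_w = (if d mod 4 = 1 then (1 - d) div 4 else - d)"
definition \<omega> :: complex where "\<omega> = (if d mod 4 = 1 then (1 + rt) / 2 else rt)"

definition wnorm :: "int \<Rightarrow> int" where "wnorm b = b\<^sup>2 + tr_w * b + nm_w"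

lemma rt_eq: "rt = \<i> * of_real (sqrt (- of_int d))"
proof -
  have "csqrt (complex_of_real (of_int d)) = \<i> * of_real (sqrt \<bar>of_int d\<bar>)"
    using csqrt_of_real_nonpos dneg by simp
  thus ?thesis using dneg by (simp add: rt_def)
qed

lemma Re_rt [simp]: "Re rt = 0" and Im_rt: "Im rt = sqrt (- of_int d)"
  and cnj_rt [simp]: "cnj rt = - rt"
  by (simp_all add: rt_eq)

lemma Im_rt_pos: "Im rt > 0" using dneg by (simp add: Im_rt)

lemma rt_sq: "rt * rt = of_int d"
  by (metis power2_csqrt power2_eq_square rt_def)

lemma Im_w: "Im \<omega> > 0" "Im \<omega> \<le> sqrt (- of_int d)"
  using Im_rt_pos by (auto simp: \<omega>_def Im_rt)

lemma w_trace: "\<omega> + cnj \<omega> = of_int tr_w"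
  by (auto simp: \<omega>_def tr_w_def field_simps)

lemma cnj_w: "cnj \<omega> = of_int tr_w - \<omega>"
  using w_trace by (simp add: algebra_simps)

lemma w_norm: "\<omega> * cnj \<omega> = of_int nm_w"
proof (cases "d mod 4 = 1")
  case True
  hence "4 * ((1 - d) div 4) = 1 - d" by presburger
  hence "(of_int (4 * ((1 - d) div 4)) :: complex) = of_int (1 - d)" by (simp only:)
  hence "(of_int ((1 - d) div 4) :: complex) = (1 - of_int d) / 4" by (simp add: mult.commute)
  thus ?thesis using True rt_sq by (simp add: \<omega>_def nm_w_def field_simps)
qed (use rt_sq in \<open>simp add: \<omega>_def nm_w_def\<close>)

lemma w_sq: "\<omega> * \<omega> = of_int tr_w * \<omega> - of_int nm_w"
  using w_norm by (simp add: cnj_w algebra_simps)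

section \<open>Coordinates and field operations in the quadratic field\<close>

lemma K_iff_rt: "x \<in> K \<longleftrightarrow> (\<exists>u v. x = of_rat u + of_rat v * rt)"
  by (simp add: quad_field_def rt_def)

lemma KI_rt: "of_rat u + of_rat v * rt \<in> K" using K_iff_rt by blast

lemma KI_w: "of_rat u + of_rat v * \<omega> \<in> K"
proof (cases "d mod 4 = 1")
  case True
  hence "of_rat u + of_rat v * \<omega> = of_rat (u + v / 2) + of_rat (v / 2) * rt"
    by (simp add: \<omega>_def of_rat_add of_rat_divide algebra_simps add_divide_distrib)
  thus ?thesis using KI_rt by metis
qed (use KI_rt in \<open>simp add: \<omega>_def\<close>)

lemma K_iff: "x \<in> K \<longleftrightarrow> (\<exists>u v. x = of_rat u + of_rat v * \<omega>)"
proof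
  assume "x \<in> K"
  then obtain u v where x: "x = of_rat u + of_rat v * rt" using K_iff_rt by blast
  show "\<exists>u v. x = of_rat u + of_rat v * \<omega>"
  proof (cases "d mod 4 = 1")
    case True
    hence "x = of_rat (u - v) + of_rat (2 * v) * \<omega>"
      by (simp add: x \<omega>_def of_rat_diff of_rat_mult field_simps)
    thus ?thesis by blast
  qed (auto simp: x \<omega>_def)
qed (use KI_w in auto)

lemma KE:
  assumes "x \<in> K" obtains u v where "x = of_rat u + of_rat v * \<omega>"
  using assms K_iff by blast

lemma w_coords_eq_iff:
  "of_rat u + of_rat v * \<omega> = of_rat u' + of_rat v' * \<omega> \<longleftrightarrow> u = u' \<and> v = v'"
proof
  assume eq: "of_rat u + of_rat v * \<omega> = of_rat u' + of_rat v' * \<omega>"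
  have "Im (of_rat u + of_rat v * \<omega>) = Im (of_rat u' + of_rat v' * \<omega>)" by (simp only: eq)
  hence "v = v'" using Im_w(1) by simp
  thus "u = u' \<and> v = v'" using eq by simp
qed simp

lemma w_coords_int_eq_iff:
  "of_int x + of_int y * \<omega> = of_int x' + of_int y' * \<omega> \<longleftrightarrow> x = x' \<and> y = y'"
  using w_coords_eq_iff[of "of_int x" "of_int y" "of_int x'" "of_int y'"] by simp

lemma K_add: "x \<in> K \<Longrightarrow> y \<in> K \<Longrightarrow> x + y \<in> K"
proof -
  assume "x \<in> K" "y \<in> K"
  then obtain u v u' v' where
    "x = of_rat u + of_rat v * rt" "y = of_rat u' + of_rat v' * rt"
    unfolding K_iff_rt by blast
  hence "x + y = of_rat (u + u') + of_rat (v + v') * rt" by (simp add: of_rat_add algebra_simps)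
  thus ?thesis using KI_rt by metis
qed

lemma K_mult: "x \<in> K \<Longrightarrow> y \<in> K \<Longrightarrow> x * y \<in> K"
proof -
  assume "x \<in> K" "y \<in> K"
  then obtain u v u' v' where
    x: "x = of_rat u + of_rat v * rt" and y: "y = of_rat u' + of_rat v' * rt"
    unfolding K_iff_rt by blast
  have "x * y = of_rat u * of_rat u' + of_rat v * of_rat v' * (rt * rt)
      + (of_rat u * of_rat v' + of_rat v * of_rat u') * rt" by (simp add: x y algebra_simps)
  also have "\<dots> = of_rat (u * u' + v * v' * of_int d) + of_rat (u * v' + v * u') * rt"
    by (simp add: rt_sq of_rat_add of_rat_mult)
  finally show ?thesis using KI_rt by metis
qed

lemma K_of_rat: "of_rat u \<in> K" using KI_rt[of u 0] by simp
lemma K_of_int: "of_int u \<in> K" using K_of_rat[of "of_int u"] by simp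
lemma K_0: "0 \<in> K" and K_1: "1 \<in> K" using K_of_int[of 0] K_of_int[of 1] by simp_all
lemma K_uminus: "x \<in> K \<Longrightarrow> - x \<in> K" using K_mult[OF K_of_int[of "-1"]] by simp
lemma K_w: "\<omega> \<in> K" using KI_w[of 0 1] by simp

lemma K_cnj: "x \<in> K \<Longrightarrow> cnj x \<in> K"
proof -
  assume "x \<in> K"
  then obtain u v where "x = of_rat u + of_rat v * rt" unfolding K_iff_rt by blast
  hence "cnj x = of_rat u + of_rat (- v) * rt" by (simp add: of_rat_minus)
  thus ?thesis using KI_rt by metis
qed

lemma K_norm_rat: "x \<in> K \<Longrightarrow> \<exists>r. x * cnj x = of_rat r"
proof -
  assume "x \<in> K"
  then obtain u v where x: "x = of_rat u + of_rat v * rt" unfolding K_iff_rt by blast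
  have "x * cnj x = of_rat u * of_rat u - of_rat v * of_rat v * (rt * rt)"
    by (simp add: x algebra_simps)
  also have "\<dots> = of_rat (u * u - v * v * of_int d)" by (simp add: rt_sq of_rat_diff of_rat_mult)
  finally show "\<exists>r. x * cnj x = of_rat r" by blast
qed

lemma K_inverse: "x \<in> K \<Longrightarrow> inverse x \<in> K"
proof (cases "x = 0")
  case False
  assume x: "x \<in> K"
  obtain r where r: "x * cnj x = of_rat r" using K_norm_rat x by blast
  have "x * cnj x \<noteq> 0" using False by simp
  hence "inverse x = cnj x * inverse (x * cnj x)" by (simp add: field_simps)
  also have "\<dots> = cnj x * of_rat (inverse r)" by (simp add: r of_rat_inverse)
  finally show ?thesis using x K_cnj K_of_rat K_mult by metis
qed (use K_0 in simp)

lemma K_divide: "x \<in> K \<Longrightarrow> y \<in> K \<Longrightarrow> x / y \<in> K"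
  by (simp add: divide_inverse K_mult K_inverse)

section \<open>Integral elements and the basis \<open>1\<close>, \<open>\<omega>\<close>\<close>

lemma Od_iff_alg: "x \<in> Od \<longleftrightarrow> x \<in> K \<and> algebraic_int x"
  by (simp add: quad_integers_def)

text \<open>The monic quadratic with roots \<open>x\<close> and \<open>cnj x\<close> is the
  witness.\<close>

lemma integral_if_trace_norm:
  assumes "x \<in> K" "x + cnj x \<in> \<int>" "x * cnj x \<in> \<int>"
  shows "x \<in> Od"
proof -
  let ?p = "[:x * cnj x, - (x + cnj x), 1:]"
  have "poly ?p x = 0" by (simp add: algebra_simps)
  moreover have "lead_coeff ?p = 1" by simp
  moreover have "\<forall>i. Polynomial.coeff ?p i \<in> \<int>"
    using assms(3) Ints_minus[OF assms(2)] by (auto simp: coeff_pCons split: nat.split)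
  ultimately have "algebraic_int x" by (rule algebraic_int.intros[rotated 2])
  thus ?thesis using assms(1) Od_iff_alg by blast
qed

text \<open>All powers of an algebraic integer \<open>x\<close> lie in a single lattice \<open>D\<^sup>-\<^sup>1 \<int>[\<surd>d]\<close>, so
  the powers of its norm have bounded denominator.\<close>

lemma shifted_norm_int_if_algebraic_int:
  assumes xK: "x \<in> K" and alg: "algebraic_int x"
  shows "(x + of_int c) * cnj (x + of_int c) \<in> \<int>"
proof -
  define L where "L = {of_int a + of_int b * rt | a b :: int. True}"
  have LI: "of_int a + of_int b * rt \<in> L" for a b :: int by (auto simp: L_def)
  have L_add: "y + z \<in> L" if "y \<in> L" "z \<in> L" for y z
  proof -
    obtain a b a' b' where "y = of_int a + of_int b * rt" "z = of_int a' + of_int b' * rt"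
      using \<open>y \<in> L\<close> \<open>z \<in> L\<close> by (auto simp: L_def)
    hence "y + z = of_int (a + a') + of_int (b + b') * rt" by (simp add: algebra_simps)
    thus ?thesis using LI by metis
  qed
  have L_mult: "y * z \<in> L" if "y \<in> L" "z \<in> L" for y z
  proof -
    obtain a b a' b' where yz: "y = of_int a + of_int b * rt" "z = of_int a' + of_int b' * rt"
      using \<open>y \<in> L\<close> \<open>z \<in> L\<close> by (auto simp: L_def)
    have "y * z = of_int a * of_int a' + of_int b * of_int b' * (rt * rt)
      + (of_int a * of_int b' + of_int b * of_int a') * rt" by (simp add: yz algebra_simps)
    also have "\<dots> = of_int (a * a' + b * b' * d) + of_int (a * b' + b * a') * rt" by (simp add: rt_sq)
    finally show ?thesis using LI by metis
  qed
  have L_int: "of_int a \<in> L" for a using LI[of a 0] by simp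
  have L_sum: "(\<Sum>i\<in>A. g i) \<in> L" if "\<And>i. i \<in> A \<Longrightarrow> g i \<in> L" "finite A" for A :: "nat set" and g
    using that(2,1) by (induction A rule: finite_induct) (use L_int[of 0] L_add in auto)
  have L_pow: "y ^ k \<in> L" if "y \<in> L" for y k
    by (induction k) (use L_int[of 1] L_mult that in auto)
  have L_norm: "y * cnj y \<in> \<int>" if "y \<in> L" for y
  proof -
    obtain a b where y: "y = of_int a + of_int b * rt" using \<open>y \<in> L\<close> by (auto simp: L_def)
    have "y * cnj y = of_int a * of_int a - of_int b * of_int b * (rt * rt)"
      by (simp add: y algebra_simps)
    thus ?thesis by (simp add: rt_sq)
  qed
  obtain u v where x: "x = of_rat u + of_rat v * rt" using xK K_iff_rt by blast
  obtain a b where ab: "quotient_of u = (a, b)" by force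
  obtain a' b' where ab': "quotient_of v = (a', b')" by force
  define m where "m = b * b'"
  have b: "b > 0" "b' > 0" "u = of_int a / of_int b" "v = of_int a' / of_int b'"
    using quotient_of_denom_pos[OF ab] quotient_of_div[OF ab]
      quotient_of_denom_pos[OF ab'] quotient_of_div[OF ab'] by auto
  have m0: "m > 0" using b by (simp add: m_def)
  have "of_int m * x = of_int (a * b') + of_int (a' * b) * rt"
    using b(1,2) by (simp add: x m_def b(3,4) of_rat_divide field_simps)
  hence mx: "of_int m * x \<in> L" using LI by metis
  obtain p where p: "poly p x = 0" "\<And>i. Polynomial.coeff p i \<in> \<int>" "lead_coeff p = 1"
    using alg by (auto elim: algebraic_int.cases)
  define n where "n = Polynomial.degree p"
  \<comment> \<open>Up to degree \<open>n\<close> the factor \<open>m ^ n\<close> clears all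
    denominators; each higher power is rewritten by the monic equation in lower ones, so the
    denominator does not grow.\<close>
  have main: "of_int (m ^ n) * x ^ k \<in> L" for k
  proof (induction k rule: less_induct)
    case (less k)
    show ?case
    proof (cases "k \<le> n")
      case True
      have "of_int (m ^ n) * x ^ k = of_int (m ^ (n - k)) * (of_int m * x) ^ k"
        using True by (simp add: power_mult_distrib flip: power_add mult.assoc)
      thus ?thesis using L_mult[OF L_int L_pow[OF mx]] by metis
    next
      case False
      have "0 = (\<Sum>i\<le>n. Polynomial.coeff p i * x ^ i)" using p(1) by (simp add: poly_altdef n_def)
      also have "\<dots> = (\<Sum>i<n. Polynomial.coeff p i * x ^ i) + x ^ n"
        using p(3) by (simp add: n_def lessThan_Suc_atMost[symmetric])
      finally have xn: "x ^ n = - (\<Sum>i<n. Polynomial.coeff p i * x ^ i)"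
        by (simp add: eq_neg_iff_add_eq_0 add.commute)
      have "x ^ k = x ^ (k - n) * x ^ n" using False by (simp flip: power_add)
      hence "of_int (m ^ n) * x ^ k = of_int (m ^ n) * x ^ (k - n) * - (\<Sum>i<n. Polynomial.coeff p i * x ^ i)"
        using xn by simp
      also have "\<dots> = (\<Sum>i<n. - Polynomial.coeff p i * (of_int (m ^ n) * x ^ (k - n + i)))"
        by (simp add: sum_distrib_left power_add sum_negf mult_ac)
      also have "\<dots> \<in> L"
      proof (rule L_sum)
        fix i assume "i \<in> {..<n}"
        hence "of_int (m ^ n) * x ^ (k - n + i) \<in> L" using False by (intro less.IH) auto
        moreover have "- Polynomial.coeff p i \<in> L" using p(2)[of i] L_int by (metis Ints_cases Ints_minus)
        ultimately show "- Polynomial.coeff p i * (of_int (m ^ n) * x ^ (k - n + i)) \<in> L" using L_mult by blast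
      qed auto
      finally show ?thesis .
    qed
  qed
  let ?y = "x + of_int c"
  have shift: "of_int (m ^ n) * ?y ^ k \<in> L" for k
  proof -
    have "of_int (m ^ n) * ?y ^ k
        = (\<Sum>j\<le>k. of_int (int (k choose j) * c ^ (k - j)) * (of_int (m ^ n) * x ^ j))"
      by (subst binomial_ring) (simp add: sum_distrib_left mult_ac)
    also have "\<dots> \<in> L" by (intro L_sum L_mult L_int main) auto
    finally show ?thesis .
  qed
  obtain r where r: "?y * cnj ?y = of_rat r" using K_norm_rat K_add[OF xK K_of_int] by blast
  \<comment> \<open>The norm is multiplicative, so the element \<open>m ^ n * ?y ^ k\<close> of
    \<open>L\<close> has the integral norm displayed here.\<close>
  have "of_int ((m ^ n)\<^sup>2) * r ^ k \<in> \<int>" for k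
  proof -
    have "(of_int (m ^ n) * ?y ^ k) * cnj (of_int (m ^ n) * ?y ^ k)
        = of_int ((m ^ n)\<^sup>2) * (?y * cnj ?y) ^ k"
      by (simp add: power2_eq_square power_mult_distrib)
    also have "\<dots> = of_rat (of_int ((m ^ n)\<^sup>2) * r ^ k)"
      by (simp only: r of_rat_mult of_rat_power of_rat_of_int_eq)
    finally have "(of_rat (of_int ((m ^ n)\<^sup>2) * r ^ k) :: complex) \<in> \<int>"
      using L_norm[OF shift[of k]] by metis
    thus ?thesis unfolding of_rat_Ints_iff .
  qed
  hence "r \<in> \<int>" by (rule rat_int_if_powers_bounded_denominator[rotated]) (use m0 in simp)
  thus ?thesis by (simp only: r of_rat_Ints_iff)
qed

lemma norm_int_if_algebraic_int:
  assumes "x \<in> K" "algebraic_int x" shows "x * cnj x \<in> \<int>"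
  using shifted_norm_int_if_algebraic_int[OF assms, of 0] by simp

text \<open>The trace is the norm of \<open>x + 1\<close> minus the norm of \<open>x\<close> minus
  1; this is why the norm was treated for shifts of \<open>x\<close>.\<close>

lemma trace_int_if_algebraic_int:
  assumes "x \<in> K" "algebraic_int x" shows "x + cnj x \<in> \<int>"
proof -
  have "(x + 1) * cnj (x + 1) \<in> \<int>"
    using shifted_norm_int_if_algebraic_int[OF assms, of 1] by simp
  hence "(x + 1) * cnj (x + 1) - x * cnj x - 1 \<in> \<int>"
    by (intro Ints_diff norm_int_if_algebraic_int[OF assms] Ints_1)
  thus ?thesis by (simp add: algebra_simps)
qed

lemma w_lin_integral: "of_int x + of_int y * \<omega> \<in> Od"
proof (rule integral_if_trace_norm)
  show "of_int x + of_int y * \<omega> \<in> K" by (intro K_add K_mult K_of_int K_w)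
  have "of_int x + of_int y * \<omega> + cnj (of_int x + of_int y * \<omega>) = of_int (2 * x + y * tr_w)"
    by (simp add: cnj_w algebra_simps)
  thus "of_int x + of_int y * \<omega> + cnj (of_int x + of_int y * \<omega>) \<in> \<int>" by (metis Ints_of_int)
  have "(of_int x + of_int y * \<omega>) * cnj (of_int x + of_int y * \<omega>)
      = of_int (x * x) + of_int (x * y) * (\<omega> + cnj \<omega>) + of_int (y * y) * (\<omega> * cnj \<omega>)"
    by (simp add: algebra_simps)
  also have "\<dots> = of_int (x * x + x * y * tr_w + y * y * nm_w)" by (simp add: w_trace w_norm)
  finally show "(of_int x + of_int y * \<omega>) * cnj (of_int x + of_int y * \<omega>) \<in> \<int>"
    by (metis Ints_of_int)
qed

text \<open>Trace and norm make \<open>2 * u\<close> and then \<open>2 * v\<close> integers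
  \<open>a\<close> and \<open>b\<close> with \<open>a * a - b * b * d = 4 * n\<close>. Residues
  modulo 4 decide the rest: if \<open>d mod 4 = 1\<close>, then \<open>a\<close> and
  \<open>b\<close> have equal parity; otherwise both are even.\<close>

lemma Od_E:
  assumes "z \<in> Od" obtains x y :: int where "z = of_int x + of_int y * \<omega>"
proof -
  have zK: "z \<in> K" and alg: "algebraic_int z" using assms Od_iff_alg by auto
  obtain u v where z: "z = of_rat u + of_rat v * rt" using zK K_iff_rt by blast
  have "z + cnj z = of_rat (2 * u)" by (simp add: z of_rat_mult)
  hence "2 * u \<in> \<int>" using trace_int_if_algebraic_int[OF zK alg] of_rat_Ints_iff by metis
  then obtain a where a: "2 * u = of_int a" by (auto elim: Ints_cases)
  have "z * cnj z = of_rat u * of_rat u - of_rat v * of_rat v * (rt * rt)"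
    by (simp add: z algebra_simps)
  also have "\<dots> = of_rat (u * u - v * v * of_int d)" by (simp add: rt_sq of_rat_diff of_rat_mult)
  finally have "u * u - v * v * of_int d \<in> \<int>"
    using norm_int_if_algebraic_int[OF zK alg] of_rat_Ints_iff by metis
  then obtain n where n: "u * u - v * v * of_int d = of_int n" by (auto elim: Ints_cases)
  have "of_int d * (2 * v)\<^sup>2 = (2 * u)\<^sup>2 - 4 * (u * u - v * v * of_int d)"
    by (simp add: algebra_simps power2_eq_square)
  also have "\<dots> \<in> \<int>" by (simp add: a n)
  finally have "2 * v \<in> \<int>" using squarefree_mult_square_int sqf by blast
  then obtain b where b: "2 * v = of_int b" by (auto elim: Ints_cases)
  have u: "u = of_int a / 2" and v: "v = of_int b / 2" using a b by auto
  have "(of_int (a * a - b * b * d) :: rat) = of_int (4 * n)"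
    using n by (simp add: u v field_simps)
  hence abn: "a * a - b * b * d = 4 * n" by (simp only: of_int_eq_iff)
  show thesis
  proof (cases "d mod 4 = 1")
    case True
    have "even (a - b)"
    proof -
      have "odd d" using True by presburger
      moreover have "even (a * a - b * b * d)" using abn by simp
      ultimately show ?thesis by auto
    qed
    then obtain c where "a - b = 2 * c" by blast
    hence "a = b + 2 * c" by simp
    hence "z = of_int c + of_int b * \<omega>"
      using True by (simp add: z u v \<omega>_def of_rat_divide of_rat_add of_rat_mult field_simps)
    thus thesis by (rule that)
  next
    case False
    have "\<not> 4 dvd d"
    proof
      assume "4 dvd d"
      hence "2\<^sup>2 dvd d" by simp
      hence "(2::int) dvd 1" using sqf unfolding squarefree_def by blast
      thus False by simp
    qed
    hence d: "d mod 4 = 2 \<or> d mod 4 = 3" using False by presburger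
    have "even a \<and> even b"
    proof -
      have sq: "(x * x) mod 4 = (if even x then 0 else 1)" for x :: int
      proof (cases "even x")
        case True thus ?thesis by auto
      next
        case False
        then obtain k where "x = 2 * k + 1" by (elim oddE)
        hence "x * x = 4 * (k * k + k) + 1" by (simp add: algebra_simps)
        thus ?thesis using False by presburger
      qed
      have "(a * a - (b * b) * d) mod 4 = 0" using abn by simp
      hence "((a * a) mod 4 - ((b * b) mod 4) * (d mod 4)) mod 4 = 0"
        using mod_diff_cong[OF mod_mod_trivial mod_mult_eq, of "a * a" 4 "b * b" d] by simp
      thus ?thesis using d by (auto simp: sq split: if_splits)
    qed
    then obtain a' b' where "a = 2 * a'" "b = 2 * b'" by blast
    hence "z = of_int a' + of_int b' * \<omega>" using False by (simp add: z u v \<omega>_def)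
    thus thesis by (rule that)
  qed
qed

lemma Od_add: "x \<in> Od \<Longrightarrow> y \<in> Od \<Longrightarrow> x + y \<in> Od"
proof (elim Od_E)
  fix a b a' b' assume "x = of_int a + of_int b * \<omega>" "y = of_int a' + of_int b' * \<omega>"
  hence "x + y = of_int (a + a') + of_int (b + b') * \<omega>" by (simp add: algebra_simps)
  thus ?thesis using w_lin_integral by metis
qed

lemma w_lin_mult: "(of_int a + of_int b * \<omega>) * (of_int a' + of_int b' * \<omega>)
  = of_int (a * a' - b * b' * nm_w) + of_int (a * b' + b * a' + b * b' * tr_w) * \<omega>"
proof -
  have "(of_int a + of_int b * \<omega>) * (of_int a' + of_int b' * \<omega>)
    = of_int (a * a') + of_int (a * b' + b * a') * \<omega> + of_int (b * b') * (\<omega> * \<omega>)"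
    by (simp add: algebra_simps)
  thus ?thesis by (simp add: w_sq algebra_simps)
qed

lemma Od_mult: "x \<in> Od \<Longrightarrow> y \<in> Od \<Longrightarrow> x * y \<in> Od"
  by (elim Od_E) (metis w_lin_mult w_lin_integral)

lemma Od_of_int: "of_int a \<in> Od" using w_lin_integral[of a 0] by simp
lemma Od_0: "0 \<in> Od" and Od_1: "1 \<in> Od" using Od_of_int[of 0] Od_of_int[of 1] by simp_all
lemma Od_w: "\<omega> \<in> Od" using w_lin_integral[of 0 1] by simp
lemma Od_uminus: "x \<in> Od \<Longrightarrow> - x \<in> Od" using Od_mult[OF Od_of_int[of "-1"]] by simp
lemma Od_K: "x \<in> Od \<Longrightarrow> x \<in> K" using Od_iff_alg by blast
lemma Od_cnj: "x \<in> Od \<Longrightarrow> cnj x \<in> Od" using K_cnj Od_iff_alg by auto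
lemma Od_power: "x \<in> Od \<Longrightarrow> x ^ k \<in> Od"
  by (induction k) (auto intro: Od_1 Od_mult)

lemma Od_rat_int: "of_rat r \<in> Od \<Longrightarrow> r \<in> \<int>"
  by (metis Od_iff_alg of_rat_Ints_iff rational_algebraic_int_is_int Rats_of_rat)

lemma Od_norm_int: "x \<in> Od \<Longrightarrow> x * cnj x \<in> \<int>"
  using norm_int_if_algebraic_int Od_iff_alg by blast

lemma wnorm_norm: "(of_int b + \<omega>) * cnj (of_int b + \<omega>) = of_int (wnorm b)"
proof -
  have "(of_int b + \<omega>) * cnj (of_int b + \<omega>) = of_int (b * b) + of_int b * (\<omega> + cnj \<omega>) + \<omega> * cnj \<omega>"
    by (simp add: algebra_simps)
  thus ?thesis by (simp add: w_trace w_norm wnorm_def power2_eq_square algebra_simps)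
qed

text \<open>This is where maximality of the order enters: otherwise \<open>(b + \<omega>) / p\<close> would be integral.\<close>

lemma wnorm_no_double_root:
  assumes p: "p > 1" and "p dvd 2 * b + tr_w" "p\<^sup>2 dvd wnorm b"
  shows False
proof -
  obtain k where k: "2 * b + tr_w = p * k" using assms(2) by blast
  obtain m where m: "wnorm b = p\<^sup>2 * m" using assms(3) by blast
  let ?z = "(of_int b + \<omega>) / of_int p"
  have "?z + cnj ?z = (of_int (2 * b) + (\<omega> + cnj \<omega>)) / of_int p" by (simp add: add_divide_distrib)
  also have "\<dots> = of_int (2 * b + tr_w) / of_int p" by (simp add: w_trace)
  also have "\<dots> = of_int k" using p by (simp add: k)
  finally have 1: "?z + cnj ?z \<in> \<int>" by simp
  have "?z * cnj ?z = ((of_int b + \<omega>) * cnj (of_int b + \<omega>)) / (of_int p)\<^sup>2"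
    by (simp add: power2_eq_square)
  also have "\<dots> = of_int m" using p by (simp only: wnorm_norm m) simp
  finally have 2: "?z * cnj ?z \<in> \<int>" by simp
  have "?z \<in> K" by (intro K_divide K_add K_of_int K_w)
  hence "?z \<in> Od" using 1 2 integral_if_trace_norm by blast
  then obtain x y where z: "?z = of_int x + of_int y * \<omega>" by (elim Od_E)
  have "of_int b + of_int 1 * \<omega> = of_int p * ?z" using p by simp
  also have "\<dots> = of_int (p * x) + of_int (p * y) * \<omega>" by (simp only: z) (simp add: algebra_simps)
  finally have "1 = p * y" unfolding w_coords_int_eq_iff by simp
  hence "p dvd 1" by (rule dvdI)
  thus False using p by auto
qed

end

subsection \<open>Fractional ideals\<close>

context imag_quad
begin

lemma quad_field_sel [simp]:
  "mult (quad_field d) = (*)" "one (quad_field d) = 1" "zero (quad_field d) = 0" "add (quad_field d) = (+)"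
  by (simp_all add: quad_field_def)

lemma quad_integers_sel [simp]:
  "mult (quad_integers d) = (*)" "one (quad_integers d) = 1"
  "zero (quad_integers d) = 0" "add (quad_integers d) = (+)"
  by (simp_all add: quad_integers_def quad_field_def)

lemma additive_subgroup_quad_field_iff:
  "additive_subgroup J (quad_field d) \<longleftrightarrow>
     J \<subseteq> K \<and> 0 \<in> J \<and> (\<forall>x\<in>J. \<forall>y\<in>J. x + y \<in> J) \<and> (\<forall>x\<in>J. - x \<in> J)"
proof -
  have inv: "inv\<^bsub>add_monoid (quad_field d)\<^esub> x = - x" if "x \<in> K" for x
    unfolding m_inv_def
  proof (rule the_equality)
    fix y assume "y \<in> carrier (add_monoid (quad_field d)) \<and>
      x \<otimes>\<^bsub>add_monoid (quad_field d)\<^esub> y = \<one>\<^bsub>add_monoid (quad_field d)\<^esub> \<and>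
      y \<otimes>\<^bsub>add_monoid (quad_field d)\<^esub> x = \<one>\<^bsub>add_monoid (quad_field d)\<^esub>"
    hence "y + x = 0" by simp
    thus "y = - x" by (simp only: eq_neg_iff_add_eq_0)
  next
    have "- x \<in> K" using that by (rule K_uminus)
    thus "- x \<in> carrier (add_monoid (quad_field d)) \<and>
      x \<otimes>\<^bsub>add_monoid (quad_field d)\<^esub> - x = \<one>\<^bsub>add_monoid (quad_field d)\<^esub> \<and>
      - x \<otimes>\<^bsub>add_monoid (quad_field d)\<^esub> x = \<one>\<^bsub>add_monoid (quad_field d)\<^esub>" by simp
  qed
  have "(\<forall>x\<in>J. inv\<^bsub>add_monoid (quad_field d)\<^esub> x \<in> J) \<longleftrightarrow> (\<forall>x\<in>J. - x \<in> J)" if "J \<subseteq> K"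
    using inv that by (metis subsetD)
  moreover have "subgroup J (add_monoid (quad_field d)) \<longleftrightarrow>
      J \<subseteq> K \<and> (\<forall>x\<in>J. \<forall>y\<in>J. x + y \<in> J) \<and> 0 \<in> J \<and>
      (\<forall>x\<in>J. inv\<^bsub>add_monoid (quad_field d)\<^esub> x \<in> J)"
    unfolding subgroup_def Ball_def by simp
  ultimately show ?thesis unfolding additive_subgroup_def by blast
qed

lemma fractional_ideal_iff:
  "fractional_ideal d J \<longleftrightarrow>
     J \<subseteq> K \<and> 0 \<in> J \<and> (\<forall>x\<in>J. \<forall>y\<in>J. x + y \<in> J) \<and> (\<forall>a\<in>Od. \<forall>x\<in>J. a * x \<in> J) \<and>
     J \<noteq> {0} \<and> (\<exists>a\<in>Od. a \<noteq> 0 \<and> (\<forall>x\<in>J. a * x \<in> Od))"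
proof -
  have m1: "- 1 \<in> Od" using Od_of_int[of "-1"] by simp
  have "- x \<in> J" if "\<forall>a\<in>Od. \<forall>x\<in>J. a * x \<in> J" "x \<in> J" for x
    using bspec[OF bspec[OF that(1) m1] that(2)] by simp
  thus ?thesis unfolding fractional_ideal_def additive_subgroup_quad_field_iff by blast
qed

lemma fracD:
  assumes "fractional_ideal d J"
  shows "J \<subseteq> K" "0 \<in> J" "x \<in> J \<Longrightarrow> y \<in> J \<Longrightarrow> x + y \<in> J" "a \<in> Od \<Longrightarrow> x \<in> J \<Longrightarrow> a * x \<in> J"
    "\<exists>x\<in>J. x \<noteq> 0" "\<exists>a\<in>Od. a \<noteq> 0 \<and> (\<forall>x\<in>J. a * x \<in> Od)"
  using assms unfolding fractional_ideal_iff by blast+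

lemma frac_diff:
  assumes "fractional_ideal d J" "x \<in> J" "y \<in> J" shows "x - y \<in> J"
  using fracD(3)[OF assms(1,2), of "-1 * y"] fracD(4)[OF assms(1) Od_of_int[of "-1"] assms(3)] by simp

section \<open>Products of sets of numbers\<close>

abbreviation fprod :: "complex set \<Rightarrow> complex set \<Rightarrow> complex set"
  where "fprod \<equiv> ideal_prod (quad_field d)"

lemma fprodI: "i \<in> I \<Longrightarrow> j \<in> J \<Longrightarrow> i * j \<in> fprod I J"
  using ideal_prod.prod[of i I j J "quad_field d"] by simp

lemma fprod_add: "x \<in> fprod I J \<Longrightarrow> y \<in> fprod I J \<Longrightarrow> x + y \<in> fprod I J"
  using ideal_prod.sum[of x "quad_field d" I J y] by simp

lemma fprod_induct [consumes 1, case_names prod sum]: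
  assumes "x \<in> fprod I J" "\<And>i j. i \<in> I \<Longrightarrow> j \<in> J \<Longrightarrow> Q (i * j)"
    "\<And>x y. x \<in> fprod I J \<Longrightarrow> y \<in> fprod I J \<Longrightarrow> Q x \<Longrightarrow> Q y \<Longrightarrow> Q (x + y)"
  shows "Q x"
  using assms(1) by (induction rule: ideal_prod.induct) (use assms(2,3) in auto)

text \<open>The product is the least set closed under addition that contains all
  \<open>i * j\<close>. Most inclusions between ideal products below are reduced to this
  form.\<close>

lemma fprod_least:
  assumes "\<And>i j. i \<in> I \<Longrightarrow> j \<in> J \<Longrightarrow> i * j \<in> L" "\<And>x y. x \<in> L \<Longrightarrow> y \<in> L \<Longrightarrow> x + y \<in> L"
  shows "fprod I J \<subseteq> L"
proof
  fix x assume "x \<in> fprod I J" thus "x \<in> L" by (induction rule: fprod_induct) (use assms in auto)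
qed

lemma fprod_mono: "I \<subseteq> I' \<Longrightarrow> J \<subseteq> J' \<Longrightarrow> fprod I J \<subseteq> fprod I' J'"
  by (rule fprod_least) (auto intro: fprodI fprod_add)

lemma fprod_comm: "fprod I J = fprod J I"
proof -
  have "fprod I J \<subseteq> fprod J I" for I J
  proof (rule fprod_least)
    show "i * j \<in> fprod J I" if "i \<in> I" "j \<in> J" for i j
      using fprodI[OF that(2,1)] by (simp add: mult.commute)
  qed (rule fprod_add)
  thus ?thesis by blast
qed

lemma fprod_assoc: "fprod (fprod I J) L = fprod I (fprod J L)"
proof -
  have 1: "fprod (fprod I J) L \<subseteq> fprod I (fprod J L)" for I J L
  proof (rule fprod_least)
    fix s l assume "s \<in> fprod I J" "l \<in> L"
    thus "s * l \<in> fprod I (fprod J L)"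
    proof (induction rule: fprod_induct)
      case (prod i j)
      thus ?case using fprodI[OF prod(1) fprodI[of j J l L]] by (simp add: mult.assoc)
    qed (simp add: distrib_right fprod_add)
  qed (rule fprod_add)
  have "fprod I (fprod J L) = fprod (fprod L J) I" by (metis fprod_comm)
  also have "\<dots> \<subseteq> fprod L (fprod J I)" by (rule 1)
  also have "\<dots> = fprod (fprod I J) L" by (metis fprod_comm)
  finally show ?thesis using 1 by blast
qed

lemma fprod_smult:
  assumes "\<And>x. x \<in> I \<Longrightarrow> a * x \<in> I" "x \<in> fprod I J" shows "a * x \<in> fprod I J"
  using assms(2)
proof (induction rule: fprod_induct)
  case (prod i j) thus ?case using fprodI[OF assms(1)[of i] prod(2)] by (simp add: mult.assoc)
qed (simp add: distrib_left fprod_add)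

lemma fprod_frac:
  assumes I: "fractional_ideal d I" and J: "fractional_ideal d J"
  shows "fractional_ideal d (fprod I J)"
  unfolding fractional_ideal_iff
proof (intro conjI ballI)
  show "fprod I J \<subseteq> K" by (rule fprod_least) (use fracD(1)[OF I] fracD(1)[OF J] K_mult K_add in blast)+
  show "0 \<in> fprod I J" using fprodI[OF fracD(2)[OF I] fracD(2)[OF J]] by simp
  show "a * x \<in> fprod I J" if "a \<in> Od" "x \<in> fprod I J" for a x
    using fprod_smult fracD(4)[OF I \<open>a \<in> Od\<close>] \<open>x \<in> fprod I J\<close> by blast
  obtain x y where "x \<in> I" "x \<noteq> 0" "y \<in> J" "y \<noteq> 0" using fracD(5)[OF I] fracD(5)[OF J] by blast
  hence "x * y \<in> fprod I J" "x * y \<noteq> 0" using fprodI by auto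
  thus "fprod I J \<noteq> {0}" by blast
  obtain a where a: "a \<in> Od" "a \<noteq> 0" "\<forall>x\<in>I. a * x \<in> Od" using fracD(6)[OF I] by blast
  obtain b where b: "b \<in> Od" "b \<noteq> 0" "\<forall>x\<in>J. b * x \<in> Od" using fracD(6)[OF J] by blast
  have "fprod I J \<subseteq> {x. a * b * x \<in> Od}"
  proof (rule fprod_least)
    fix i j assume "i \<in> I" "j \<in> J"
    hence "(a * i) * (b * j) \<in> Od" using Od_mult[of "a * i" "b * j"] a b by blast
    thus "i * j \<in> {x. a * b * x \<in> Od}" by (simp add: mult_ac)
  qed (auto simp: distrib_left intro: Od_add)
  thus "\<exists>a\<in>Od. a \<noteq> 0 \<and> (\<forall>x\<in>fprod I J. a * x \<in> Od)"
    using a b by (intro bexI[of _ "a * b"]) (auto intro: Od_mult)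
qed (rule fprod_add)

lemma fprod_Od:
  assumes "0 \<in> J" "\<And>x y. x \<in> J \<Longrightarrow> y \<in> J \<Longrightarrow> x + y \<in> J" "\<And>a x. a \<in> Od \<Longrightarrow> x \<in> J \<Longrightarrow> a * x \<in> J"
  shows "fprod Od J = J"
proof
  show "fprod Od J \<subseteq> J" by (rule fprod_least) (use assms in auto)
  show "J \<subseteq> fprod Od J" using fprodI[OF Od_1] by force
qed

lemma frac_fprod_Od: "fractional_ideal d J \<Longrightarrow> fprod Od J = J"
  using fprod_Od fracD(2-4) by metis

section \<open>Multiplying an ideal by a number\<close>

definition scale :: "complex \<Rightarrow> complex set \<Rightarrow> complex set" where "scale c J = (*) c ` J"

lemma scale_mem: "c \<noteq> 0 \<Longrightarrow> x \<in> scale c J \<longleftrightarrow> x / c \<in> J"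
proof
  assume "c \<noteq> 0" "x / c \<in> J"
  moreover have "x = c * (x / c)" using \<open>c \<noteq> 0\<close> by simp
  ultimately show "x \<in> scale c J" unfolding scale_def by blast
qed (auto simp: scale_def)

lemma scaleI: "x \<in> J \<Longrightarrow> c * x \<in> scale c J" by (auto simp: scale_def)

lemma scale_1 [simp]: "scale 1 J = J" by (simp add: scale_def)
lemma scale_scale: "scale a (scale b J) = scale (a * b) J" by (auto simp: scale_def image_image mult.assoc)

lemma fprod_scale: "fprod (scale c I) J = scale c (fprod I J)"
proof
  show "fprod (scale c I) J \<subseteq> scale c (fprod I J)"
  proof (rule fprod_least)
    fix i j assume "i \<in> scale c I" "j \<in> J"
    then obtain k where "k \<in> I" "i = c * k" by (auto simp: scale_def)
    thus "i * j \<in> scale c (fprod I J)" using scaleI[OF fprodI[OF \<open>k \<in> I\<close> \<open>j \<in> J\<close>], of c] by (simp add: mult.assoc)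
  next
    fix x y assume "x \<in> scale c (fprod I J)" "y \<in> scale c (fprod I J)"
    then obtain x' y' where "x' \<in> fprod I J" "x = c * x'" "y' \<in> fprod I J" "y = c * y'" by (auto simp: scale_def)
    thus "x + y \<in> scale c (fprod I J)" using scaleI[OF fprod_add, of x' I J y' c] by (simp add: distrib_left)
  qed
  have "fprod I J \<subseteq> {x. c * x \<in> fprod (scale c I) J}"
  proof (rule fprod_least)
    show "i * j \<in> {x. c * x \<in> fprod (scale c I) J}" if "i \<in> I" "j \<in> J" for i j
      using fprodI[OF scaleI[OF that(1)] that(2)] by (simp add: mult.assoc)
  qed (simp add: distrib_left fprod_add)
  thus "scale c (fprod I J) \<subseteq> fprod (scale c I) J" by (auto simp: scale_def)
qed

lemma fprod_scale_right: "fprod I (scale c J) = scale c (fprod I J)"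
  by (metis fprod_comm fprod_scale)

lemma scale_frac:
  assumes J: "fractional_ideal d J" and c: "c \<in> K" "c \<noteq> 0"
  shows "fractional_ideal d (scale c J)"
  unfolding fractional_ideal_iff
proof (intro conjI ballI)
  show "scale c J \<subseteq> K" using fracD(1)[OF J] c by (auto simp: scale_def intro!: K_mult)
  show "0 \<in> scale c J" using scaleI[OF fracD(2)[OF J], of c] by simp
  show "x + y \<in> scale c J" if "x \<in> scale c J" "y \<in> scale c J" for x y
    using that fracD(3)[OF J] c by (simp add: scale_mem add_divide_distrib)
  show "a * x \<in> scale c J" if "a \<in> Od" "x \<in> scale c J" for a x
    using that fracD(4)[OF J, of a "x / c"] c by (simp add: scale_mem)
  obtain x where "x \<in> J" "x \<noteq> 0" using fracD(5)[OF J] by blast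
  hence "c * x \<in> scale c J" "c * x \<noteq> 0" using scaleI c by auto
  thus "scale c J \<noteq> {0}" by blast
  obtain a where a: "a \<in> Od" "a \<noteq> 0" "\<forall>x\<in>J. a * x \<in> Od" using fracD(6)[OF J] by blast
  \<comment> \<open>Clearing the denominators \<open>m'\<close> and \<open>n'\<close> of the
    coordinates of \<open>inverse c\<close> makes \<open>m' * n' * inverse c\<close> integral; its
    product with a common denominator of \<open>J\<close> is one for
    \<open>scale c J\<close>.\<close>
  obtain u v where uv: "inverse c = of_rat u + of_rat v * \<omega>" using KE[OF K_inverse[OF c(1)]] by blast
  obtain m m' where m: "quotient_of u = (m, m')" by force
  obtain n n' where n: "quotient_of v = (n, n')" by force
  have mn: "m' > 0" "n' > 0" "u = of_int m / of_int m'" "v = of_int n / of_int n'"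
    using quotient_of_denom_pos[OF m] quotient_of_div[OF m]
      quotient_of_denom_pos[OF n] quotient_of_div[OF n] by auto
  have "of_int (m' * n') * (of_rat u :: complex) = of_int (m * n')"
    "of_int (m' * n') * (of_rat v :: complex) = of_int (n * m')"
    using mn(1,2) by (simp_all add: mn(3,4) of_rat_divide)
  hence "of_int (m' * n') * inverse c = of_int (m * n') + of_int (n * m') * \<omega>"
    by (simp only: uv distrib_left mult.assoc[symmetric])
  hence e: "of_int (m' * n') * inverse c \<in> Od" using w_lin_integral by metis
  show "\<exists>a\<in>Od. a \<noteq> 0 \<and> (\<forall>x\<in>scale c J. a * x \<in> Od)"
  proof (intro bexI conjI ballI)
    show "a * (of_int (m' * n') * inverse c) \<in> Od" using a(1) e by (rule Od_mult)
    show "a * (of_int (m' * n') * inverse c) \<noteq> 0" using a mn c by simp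
    fix x assume "x \<in> scale c J"
    then obtain y where y: "y \<in> J" "x = c * y" by (auto simp: scale_def)
    have "of_int (m' * n') * (a * y) \<in> Od" using Od_mult[OF Od_of_int, of "a * y"] y a by blast
    moreover have "a * (of_int (m' * n') * inverse c) * x = of_int (m' * n') * (a * y)"
      using c by (simp add: y(2) field_simps)
    ultimately show "a * (of_int (m' * n') * inverse c) * x \<in> Od" by (simp only:)
  qed
qed

text \<open>The lattice \<open>\<int> a + \<int> (b + \<omega>)\<close>; it is an ideal when \<open>a\<close> divides the norm of \<open>b + \<omega>\<close>.\<close>

definition quad_ideal :: "int \<Rightarrow> int \<Rightarrow> complex set" where
  "quad_ideal a b = {of_int x + of_int y * \<omega> | x y. a dvd x - b * y}"

text \<open>Since \<open>x + y * \<omega> = (x - b * y) + y * (b + \<omega>)\<close>, membership in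
  the lattice is a single divisibility.\<close>

lemma quad_ideal_iff: "of_int x + of_int y * \<omega> \<in> quad_ideal a b \<longleftrightarrow> a dvd x - b * y"
  unfolding quad_ideal_def using w_coords_int_eq_iff by auto

lemma quad_ideal_sub: "quad_ideal a b \<subseteq> Od" by (auto simp: quad_ideal_def w_lin_integral)

lemma quad_ideal_add: "x \<in> quad_ideal a b \<Longrightarrow> y \<in> quad_ideal a b \<Longrightarrow> x + y \<in> quad_ideal a b"
proof -
  assume "x \<in> quad_ideal a b" "y \<in> quad_ideal a b"
  then obtain u v u' v' where x: "x = of_int u + of_int v * \<omega>" "a dvd u - b * v"
    and y: "y = of_int u' + of_int v' * \<omega>" "a dvd u' - b * v'" by (auto simp: quad_ideal_def)
  have "x + y = of_int (u + u') + of_int (v + v') * \<omega>" by (simp add: x y algebra_simps)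
  moreover have "a dvd (u + u') - b * (v + v')"
    using dvd_add[OF x(2) y(2)] by (simp add: algebra_simps)
  ultimately show ?thesis using quad_ideal_iff by metis
qed

text \<open>\<open>wnorm b\<close> is the value at \<open>- b\<close> of the minimal polynomial of
  \<open>\<omega>\<close>. So if \<open>a\<close> divides it, \<open>x + y * \<omega>\<close> goes
  to \<open>x - b * y\<close> under a ring homomorphism to the integers modulo \<open>a\<close>, and
  the lattice is its kernel.\<close>

lemma quad_ideal_mult:
  assumes "a dvd wnorm b" "r \<in> Od" "x \<in> quad_ideal a b" shows "r * x \<in> quad_ideal a b"
proof -
  obtain u v where r: "r = of_int u + of_int v * \<omega>" using assms(2) by (elim Od_E)
  obtain y z where x: "x = of_int y + of_int z * \<omega>" "a dvd y - b * z" using assms(3) by (auto simp: quad_ideal_def)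
  have "(u * y - v * z * nm_w) - b * (u * z + v * y + v * z * tr_w)
      = (u - b * v) * (y - b * z) - v * z * wnorm b"
    by (simp add: wnorm_def power2_eq_square algebra_simps)
  moreover have "a dvd (u - b * v) * (y - b * z) - v * z * wnorm b" 
    by (rule dvd_diff[OF dvd_mult[OF x(2)] dvd_mult[OF assms(1)]])
  ultimately show ?thesis by (simp only: r x(1) w_lin_mult quad_ideal_iff)
qed

lemma quad_ideal_a: "of_int a \<in> quad_ideal a b" using quad_ideal_iff[of a 0 a b] by simp
lemma quad_ideal_bw: "of_int b + \<omega> \<in> quad_ideal a b" using quad_ideal_iff[of b 1 a b] by simp
lemma quad_ideal_0: "0 \<in> quad_ideal a b" using quad_ideal_iff[of 0 0 a b] by simp

lemma Od_frac: "fractional_ideal d Od"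
  unfolding fractional_ideal_iff
  using Od_0 Od_1 Od_add Od_mult Od_K by (auto intro!: bexI[of _ 1])

lemma integral_frac:
  assumes "J \<subseteq> Od" "0 \<in> J" "\<And>x y. x \<in> J \<Longrightarrow> y \<in> J \<Longrightarrow> x + y \<in> J"
    "\<And>a x. a \<in> Od \<Longrightarrow> x \<in> J \<Longrightarrow> a * x \<in> J" "J \<noteq> {0}"
  shows "fractional_ideal d J"
  unfolding fractional_ideal_iff
  using assms Od_K Od_1 by (auto intro!: bexI[of _ 1])

lemma quad_ideal_frac:
  assumes "a \<noteq> 0" "a dvd wnorm b" shows "fractional_ideal d (quad_ideal a b)"
proof (rule integral_frac)
  show "quad_ideal a b \<noteq> {0}" using quad_ideal_a[of a b] assms(1) by auto
qed (use quad_ideal_sub quad_ideal_0 quad_ideal_add quad_ideal_mult assms(2) in auto)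

lemma wnorm_conj: "wnorm (- b - tr_w) = wnorm b"
  by (simp add: wnorm_def power2_eq_square algebra_simps)

lemma cnj_w_lin: "cnj (of_int x + of_int y * \<omega>) = of_int (x + y * tr_w) + of_int (- y) * \<omega>"
  by (simp add: cnj_w algebra_simps)

text \<open>The conjugate of \<open>b + \<omega>\<close> is minus
  \<open>(- b - tr_w) + \<omega>\<close>: conjugation exchanges the two roots of
  \<open>wnorm\<close>.\<close>

lemma cnj_quad_ideal: "cnj ` quad_ideal a b = quad_ideal a (- b - tr_w)"
proof -
  have 1: "cnj ` quad_ideal a b \<subseteq> quad_ideal a (- b - tr_w)" for b
  proof
    fix z assume "z \<in> cnj ` quad_ideal a b"
    then obtain x y where z: "z = cnj (of_int x + of_int y * \<omega>)" "a dvd x - b * y" by (auto simp: quad_ideal_def)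
    have "(x + y * tr_w) - (- b - tr_w) * (- y) = x - b * y" by (simp add: algebra_simps)
    thus "z \<in> quad_ideal a (- b - tr_w)" using z by (simp only: cnj_w_lin quad_ideal_iff)
  qed
  have "cnj ` cnj ` quad_ideal a (- b - tr_w) \<subseteq> cnj ` quad_ideal a b" using 1[of "- b - tr_w"] by (intro image_mono) simp
  thus ?thesis using 1[of b] by (simp add: image_image)
qed

text \<open>With \<open>wnorm b = a * c\<close>, the product contains \<open>a\<close> times each of
  \<open>a\<close>, \<open>2 * b + tr_w\<close> and \<open>c\<close>, and these three have no common
  factor.\<close>

lemma quad_ideal_mult_conj:
  assumes a: "a > 0" and dvd: "a dvd wnorm b"
  shows "fprod (quad_ideal a b) (quad_ideal a (- b - tr_w)) = scale (of_int a) Od"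
proof
  let ?b = "- b - tr_w"
  show "fprod (quad_ideal a b) (quad_ideal a ?b) \<subseteq> scale (of_int a) Od"
  proof (rule fprod_least)
    fix i j assume "i \<in> quad_ideal a b" "j \<in> quad_ideal a ?b"
    then obtain x y x' y' where i: "i = of_int x + of_int y * \<omega>" "a dvd x - b * y"
      and j: "j = of_int x' + of_int y' * \<omega>" "a dvd x' - ?b * y'" unfolding quad_ideal_def by blast
    have "x * x' - y * y' * nm_w = x' * (x - b * y) + b * y * (x' - ?b * y') - y * y' * wnorm b"
      by (simp add: wnorm_def power2_eq_square algebra_simps)
    moreover have "a dvd x' * (x - b * y) + b * y * (x' - ?b * y') - y * y' * wnorm b"
      by (intro dvd_diff dvd_add dvd_mult i(2) j(2) dvd)
    ultimately obtain k where k: "x * x' - y * y' * nm_w = a * k" by (metis dvdE)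
    have "x * y' + y * x' + y * y' * tr_w = y' * (x - b * y) + y * (x' - ?b * y')"
      by (simp add: algebra_simps)
    moreover have "a dvd y' * (x - b * y) + y * (x' - ?b * y')"
      by (intro dvd_add dvd_mult i(2) j(2))
    ultimately obtain m where m: "x * y' + y * x' + y * y' * tr_w = a * m" by (metis dvdE)
    have "i * j = of_int a * (of_int k + of_int m * \<omega>)"
      by (simp only: i(1) j(1) w_lin_mult k m) (simp add: algebra_simps)
    thus "i * j \<in> scale (of_int a) Od" using scaleI[OF w_lin_integral] by metis
  next
    fix x y :: complex assume "x \<in> scale (of_int a) Od" "y \<in> scale (of_int a) Od"
    thus "x + y \<in> scale (of_int a) Od" using a by (simp add: scale_mem add_divide_distrib Od_add)
  qed
  obtain c where c: "wnorm b = a * c" using dvd by blast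
  \<comment> \<open>\<open>g\<close> is the content of the binary quadratic form with coefficients
    \<open>a\<close>, \<open>2 * b + tr_w\<close>, \<open>c\<close>. If it exceeded 1,
    \<open>b\<close> would be a double root modulo \<open>g\<close>, with \<open>g\<close> squared
    dividing \<open>wnorm b\<close>.\<close>
  define g where "g = gcd a (gcd (2 * b + tr_w) c)"
  have "g = 1"
  proof (rule ccontr)
    assume "g \<noteq> 1"
    moreover have "g > 0" using a by (simp add: g_def)
    ultimately have "g > 1" by simp
    moreover have "g dvd 2 * b + tr_w" "g dvd a" "g dvd c" unfolding g_def by (auto intro: dvd_trans)
    ultimately show False
      using wnorm_no_double_root[of g b] by (simp add: c power2_eq_square mult_dvd_mono)
  qed
  obtain u v where uv: "u * a + v * gcd (2 * b + tr_w) c = 1" using bezout_int \<open>g = 1\<close> g_def by metis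
  obtain u' v' where uv': "u' * (2 * b + tr_w) + v' * c = gcd (2 * b + tr_w) c" using bezout_int by metis
  let ?P = "fprod (quad_ideal a b) (quad_ideal a ?b)"
  have mult: "r * x \<in> ?P" if "r \<in> Od" "x \<in> ?P" for r x
    using fprod_smult[OF _ that(2)] quad_ideal_mult[OF dvd that(1)] by blast
  have 1: "of_int a * of_int a \<in> ?P" by (rule fprodI[OF quad_ideal_a quad_ideal_a])
  have 2: "of_int a * (of_int ?b + \<omega>) \<in> ?P" by (rule fprodI[OF quad_ideal_a quad_ideal_bw])
  have 3: "of_int a * (of_int b + \<omega>) \<in> ?P"
    using fprodI[OF quad_ideal_bw quad_ideal_a, of b a a ?b] by (simp only: mult.commute)
  have 4: "(of_int b + \<omega>) * (of_int ?b + \<omega>) \<in> ?P" by (rule fprodI[OF quad_ideal_bw quad_ideal_bw])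
  \<comment> \<open>The coefficients come from two nested Bezout identities. The second and third
    terms add up to a multiple of \<open>a * (2 * b + tr_w)\<close>; the last product equals minus
    \<open>wnorm b\<close>, hence the sign of \<open>v * v'\<close>.\<close>
  have "of_int u * (of_int a * of_int a)
     + (of_int (- (v * u')) * (of_int a * (of_int ?b + \<omega>)) + of_int (v * u') * (of_int a * (of_int b + \<omega>))
     + of_int (- (v * v')) * ((of_int b + \<omega>) * (of_int ?b + \<omega>))) \<in> ?P"
    by (rule fprod_add[OF mult[OF Od_of_int 1] fprod_add[OF fprod_add[OF mult[OF Od_of_int 2]
          mult[OF Od_of_int 3]] mult[OF Od_of_int 4]]])
  also have "(of_int b + \<omega>) * (of_int ?b + \<omega>) = - (of_int b + \<omega>) * cnj (of_int b + \<omega>)"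
    by (simp add: cnj_w algebra_simps)
  also have "\<dots> = - of_int (wnorm b)" by (simp only: wnorm_norm mult_minus_left)
  also have "of_int u * (of_int a * of_int a)
     + (of_int (- (v * u')) * (of_int a * (of_int ?b + \<omega>)) + of_int (v * u') * (of_int a * (of_int b + \<omega>))
     + of_int (- (v * v')) * (- of_int (wnorm b)))
     = of_int (a * (u * a + v * (u' * (2 * b + tr_w) + v' * c)))"
    by (simp add: c algebra_simps)
  also have "\<dots> = of_int a" by (simp only: uv' uv) simp
  finally have a_in: "of_int a \<in> ?P" .
  show "scale (of_int a) Od \<subseteq> ?P"
    using mult[OF _ a_in] by (auto simp: scale_def mult.commute)
qed

end

subsection \<open>Reduction and the class group\<close>

context imag_quad
begin

abbreviation "IG \<equiv> fractional_ideal_group d"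
abbreviation "PG \<equiv> principal_fractional_ideals d"

lemma fractional_ideal_group_sel [simp]:
  "mult IG = fprod" "one IG = Od" "J \<in> carrier IG \<longleftrightarrow> fractional_ideal d J"
  by (simp_all add: fractional_ideal_group_def)

lemma PG_iff: "J \<in> PG \<longleftrightarrow> (\<exists>c\<in>K. c \<noteq> 0 \<and> J = scale c Od)"
  by (auto simp: principal_fractional_ideals_def scale_def)

lemma PG_I: "c \<in> K \<Longrightarrow> c \<noteq> 0 \<Longrightarrow> scale c Od \<in> PG" unfolding PG_iff by blast

lemma PG_E:
  assumes "J \<in> PG" obtains c where "c \<in> K" "c \<noteq> 0" "J = scale c Od"
  using assms unfolding PG_iff by blast

section \<open>Shortest vectors and reduced lattices\<close>

lemma cmod_sq_int:
  assumes "x \<in> Od" shows "(cmod x)\<^sup>2 \<in> \<int>"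
proof -
  obtain m where "x * cnj x = of_int m" using Od_norm_int[OF assms] by (auto elim: Ints_cases)
  hence "complex_of_real ((cmod x)\<^sup>2) = of_real (of_int m)" 
    by (simp only: complex_norm_square of_real_of_int_eq)
  hence "(cmod x)\<^sup>2 = of_int m" by (simp only: of_real_eq_iff)
  thus ?thesis by simp
qed

text \<open>After multiplication by a common denominator \<open>q\<close>, squared absolute values
  are natural numbers, so a minimum is attained.\<close>

lemma frac_shortest:
  assumes J: "fractional_ideal d J"
  obtains c where "c \<in> J" "c \<noteq> 0" "\<And>x. x \<in> J \<Longrightarrow> x \<noteq> 0 \<Longrightarrow> cmod c \<le> cmod x"
proof -
  obtain q where q: "q \<in> Od" "q \<noteq> 0" "\<forall>x\<in>J. q * x \<in> Od" using fracD(6)[OF J] by blast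
  define \<mu> where "\<mu> x = nat \<lfloor>(cmod (q * x))\<^sup>2\<rfloor>" for x
  have \<mu>: "real (\<mu> x) = (cmod (q * x))\<^sup>2" if "x \<in> J" for x
    using cmod_sq_int[of "q * x"] q(3) that by (auto simp: \<mu>_def elim!: Ints_cases)
  obtain x0 where "x0 \<in> J \<and> x0 \<noteq> 0" using fracD(5)[OF J] by blast
  then obtain c where c: "c \<in> J" "c \<noteq> 0" "\<And>x. x \<in> J \<Longrightarrow> x \<noteq> 0 \<Longrightarrow> \<mu> c \<le> \<mu> x"
    using ex_has_least_nat[of "\<lambda>x. x \<in> J \<and> x \<noteq> 0" x0 \<mu>] by blast
  have "cmod c \<le> cmod x" if x: "x \<in> J" "x \<noteq> 0" for x
  proof -
    have "(cmod (q * c))\<^sup>2 \<le> (cmod (q * x))\<^sup>2"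
      using c(3)[OF x] by (simp only: \<mu>[OF c(1), symmetric] \<mu>[OF x(1), symmetric] of_nat_le_iff)
    hence "cmod (q * c) \<le> cmod (q * x)" by (rule power2_le_imp_le) simp
    thus ?thesis using q(2) by (simp add: norm_mult)
  qed
  thus thesis using c that by blast
qed

text \<open>Dividing by a shortest nonzero vector, we may assume that 1 is a shortest vector.  The
  lattice is then \<open>\<int> + \<int> \<tau>\<close> with \<open>\<tau>\<close> in the usual fundamental domain, whence the bound on \<open>a\<close>.\<close>

lemma frac_reduced:
  assumes J: "fractional_ideal d J" and one: "1 \<in> J" and short: "\<And>x. x \<in> J \<Longrightarrow> x \<noteq> 0 \<Longrightarrow> 1 \<le> cmod x"
  obtains a b where "a > 0" "0 \<le> b" "b < a" "a dvd wnorm b" "real_of_int a \<le> 2 * sqrt (- of_int d)"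
    "scale (of_int a) J = quad_ideal a b"
proof -
  have OJ: "x \<in> J" if "x \<in> Od" for x using fracD(4)[OF J that one] by simp
  have intJ: "of_int m * x \<in> J" if "x \<in> J" for m x using fracD(4)[OF J Od_of_int that] .
  \<comment> \<open>The fractional part of a non-integral rational element would be a nonzero
    element of \<open>J\<close> shorter than 1.\<close>
  have rat: "r \<in> \<int>" if r: "of_rat r \<in> J" for r
  proof (rule ccontr)
    assume nint: "r \<notin> \<int>"
    let ?s = "r - of_int \<lfloor>r\<rfloor>"
    have "of_rat ?s \<in> J" using frac_diff[OF J r OJ[OF Od_of_int]] by (simp add: of_rat_diff)
    moreover have "?s \<noteq> 0" using nint by (metis Ints_of_int eq_iff_diff_eq_0)
    ultimately have "1 \<le> cmod (of_rat ?s)" by (intro short) auto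
    also have "cmod (of_rat ?s) = \<bar>of_rat ?s :: real\<bar>" by (simp only: of_rat_complex norm_of_real)
    also have "\<dots> < 1"
    proof -
      have "0 \<le> ?s" "?s < 1" by linarith+
      hence "0 \<le> (of_rat ?s :: real)" "(of_rat ?s :: real) < 1"
        by (simp_all only: zero_le_of_rat_iff of_rat_less_1_iff)
      thus ?thesis by linarith
    qed
    finally show False by simp
  qed
  obtain q where q: "q \<in> Od" "q \<noteq> 0" "\<forall>x\<in>J. q * x \<in> Od" using fracD(6)[OF J] by blast
  obtain N where N: "(cmod q)\<^sup>2 = of_int N" using cmod_sq_int[OF q(1)] by (auto elim: Ints_cases)
  have "(cmod q)\<^sup>2 > 0" using q(2) by simp
  hence N0: "N > 0" by (simp add: N)
  have qN: "cnj q * q = of_int N"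
    using N by (metis complex_norm_square mult.commute of_real_of_int_eq)
  \<comment> \<open>Multiplication by \<open>cnj q * q = N\<close> takes \<open>J\<close> into the
    ring of integers, so \<open>N\<close> is a common denominator of the coordinates.\<close>
  have coord: "of_int N * v \<in> \<int>" if "of_rat u + of_rat v * \<omega> \<in> J" for u v
  proof -
    have "cnj q * (q * (of_rat u + of_rat v * \<omega>)) \<in> Od"
      using Od_mult[OF Od_cnj[OF q(1)]] q(3) that by blast
    then obtain x y where "cnj q * (q * (of_rat u + of_rat v * \<omega>)) = of_int x + of_int y * \<omega>" by (elim Od_E)
    hence "of_int N * (of_rat u + of_rat v * \<omega>) = of_int x + of_int y * \<omega>"
      using qN by (metis mult.assoc)
    hence "of_rat (of_int N * u) + of_rat (of_int N * v) * \<omega> = of_rat (of_int x) + of_rat (of_int y) * \<omega>"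
      by (simp add: of_rat_mult algebra_simps)
    thus ?thesis unfolding w_coords_eq_iff by simp
  qed
  \<comment> \<open>\<open>Q\<close> collects the positive \<open>\<omega>\<close>-coordinates,
    scaled by \<open>N\<close> to natural numbers. The least one yields a coordinate
    \<open>v0\<close> of which, by division with remainder, all others are integer
    multiples.\<close>
  define Q where "Q k \<longleftrightarrow> k > 0 \<and> (\<exists>u v. of_rat u + of_rat v * \<omega> \<in> J \<and> of_int N * v = of_nat k)" for k :: nat
  have "Q (nat N)"
  proof -
    have "of_rat 0 + of_rat 1 * \<omega> \<in> J \<and> of_int N * (1 :: rat) = of_nat (nat N)"
      using N0 OJ[OF Od_w] by simp
    moreover have "nat N > 0" using N0 by simp
    ultimately show ?thesis unfolding Q_def by blast
  qed
  define k0 where "k0 = (LEAST k. Q k)"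
  have "Q k0" unfolding k0_def using \<open>Q (nat N)\<close> by (rule LeastI)
  then obtain u0 v0 where k0: "k0 > 0" "of_rat u0 + of_rat v0 * \<omega> \<in> J" "of_int N * v0 = of_nat k0"
    unfolding Q_def by blast
  have least: "k0 \<le> k" if "Q k" for k unfolding k0_def using that by (rule Least_le)
  have multiple: "\<exists>m::int. v = of_int m * v0" if uv: "of_rat u + of_rat v * \<omega> \<in> J" for u v
  proof -
    obtain k where k: "of_int N * v = of_int k" using coord[OF uv] by (auto elim: Ints_cases)
    let ?m = "k div int k0" and ?r = "k mod int k0"
    have "of_rat u + of_rat v * \<omega> - of_int ?m * (of_rat u0 + of_rat v0 * \<omega>) \<in> J"
      using uv intJ[OF k0(2)] by (rule frac_diff[OF J])
    also have "of_rat u + of_rat v * \<omega> - of_int ?m * (of_rat u0 + of_rat v0 * \<omega>)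
        = of_rat (u - of_int ?m * u0) + of_rat (v - of_int ?m * v0) * \<omega>"
      by (simp add: of_rat_diff of_rat_mult algebra_simps)
    finally have *: "of_rat (u - of_int ?m * u0) + of_rat (v - of_int ?m * v0) * \<omega> \<in> J" .
    have "of_int N * (v - of_int ?m * v0) = of_int k - of_int ?m * of_nat k0"
      by (simp only: right_diff_distrib k k0(3)[symmetric]) (simp add: mult_ac)
    also have "\<dots> = of_int (k - ?m * int k0)" by simp
    also have "\<dots> = of_int ?r" by (simp only: minus_div_mult_eq_mod)
    finally have **: "of_int N * (v - of_int ?m * v0) = of_int ?r" .
    have "?r = 0"
    proof (rule ccontr)
      assume "?r \<noteq> 0"
      moreover have r: "?r \<ge> 0" "?r < int k0" using k0(1) by auto
      ultimately have "?r > 0" by linarith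
      hence "Q (nat ?r)" unfolding Q_def using * ** by auto
      hence "k0 \<le> nat ?r" by (rule least)
      thus False using r by linarith
    qed
    hence "v = of_int ?m * v0" using ** N0 by simp
    thus ?thesis by blast
  qed
  \<comment> \<open>\<open>\<omega>\<close> lies in \<open>J\<close> and has coordinate 1, so
    \<open>v0\<close> is the reciprocal of an integer.\<close>
  obtain a where a: "1 = of_int a * v0" using multiple[of 0 1] OJ[OF Od_w] by auto
  have "v0 > 0"
  proof (rule ccontr)
    assume "\<not> v0 > 0"
    hence "of_int N * v0 \<le> 0" using N0 by (simp add: mult_le_0_iff)
    thus False using k0(1,3) by simp
  qed
  hence a0: "a > 0" using a by (metis of_int_0_less_iff zero_less_mult_pos2 zero_less_one)
  have v0: "v0 = 1 / of_int a" using a a0 by (simp add: field_simps)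
  have "of_int a * (of_rat u0 + of_rat v0 * \<omega>) - \<omega> = of_rat (of_int a * u0)"
    using a0 by (simp add: v0 of_rat_divide of_rat_mult field_simps)
  moreover have "of_int a * (of_rat u0 + of_rat v0 * \<omega>) - \<omega> \<in> J"
    using frac_diff[OF J intJ[OF k0(2)] OJ[OF Od_w]] .
  ultimately have "of_int a * u0 \<in> \<int>" using rat by simp
  then obtain b1 where b1: "of_int a * u0 = of_int b1" by (auto elim: Ints_cases)
  define b where "b = b1 mod a"
  define \<tau> where "\<tau> = (of_int b + \<omega>) / of_int a"
  have u0: "u0 = of_int b1 / of_int a" using b1 a0 by (simp add: field_simps)
  have "of_int b1 = (of_int (a * (b1 div a) + b) :: complex)" by (simp add: b_def)
  hence b1': "of_int b1 = (of_int a * of_int (b1 div a) + of_int b :: complex)" by simp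
  have "of_rat u0 + of_rat v0 * \<omega> - of_int (b1 div a) = (of_int b1 + \<omega> - of_int a * of_int (b1 div a)) / of_int a"
    using a0 by (simp add: u0 v0 of_rat_divide field_simps)
  also have "\<dots> = \<tau>" by (simp add: b1' \<tau>_def)
  finally have \<tau>J: "\<tau> \<in> J" using frac_diff[OF J k0(2) OJ[OF Od_of_int]] by metis
  have b: "0 \<le> b" "b < a" using a0 by (auto simp: b_def)
  have \<tau>_rat: "\<tau> = of_rat (of_int b / of_int a) + of_rat (1 / of_int a) * \<omega>"
    by (simp add: \<tau>_def of_rat_divide add_divide_distrib)
  \<comment> \<open>\<open>J\<close> is stable under \<open>\<omega>\<close>, so it contains
    \<open>(b + tr_w) * \<tau> - \<omega> * \<tau>\<close>. This is the rational number
    \<open>wnorm b / a\<close>, which must therefore be an integer.\<close>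
  have "a dvd wnorm b"
  proof -
    have "(of_int b + \<omega>) * \<omega> = of_int (b + tr_w) * (of_int b + \<omega>) - of_int (wnorm b)"
      by (simp add: distrib_right w_sq wnorm_def power2_eq_square algebra_simps)
    hence "of_int (b + tr_w) * (of_int b + \<omega>) - \<omega> * (of_int b + \<omega>) = of_int (wnorm b)"
      by (simp add: mult.commute)
    moreover have "of_int (b + tr_w) * \<tau> - \<omega> * \<tau>
        = (of_int (b + tr_w) * (of_int b + \<omega>) - \<omega> * (of_int b + \<omega>)) / of_int a"
      by (simp only: \<tau>_def times_divide_eq_right diff_divide_distrib)
    ultimately have "of_int (b + tr_w) * \<tau> - \<omega> * \<tau> = of_int (wnorm b) / of_int a" by (simp only:)
    also have "\<dots> = of_rat (of_int (wnorm b) / of_int a)" by (simp add: of_rat_divide)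
    finally have "of_rat (of_int (wnorm b) / of_int a) \<in> J"
      using frac_diff[OF J intJ[OF \<tau>J] fracD(4)[OF J Od_w \<tau>J]] by metis
    hence "(of_int (wnorm b) / of_int a :: rat) \<in> \<int>" by (rule rat)
    then obtain m where "(of_int (wnorm b) / of_int a :: rat) = of_int m" by (auto elim: Ints_cases)
    hence "(of_int (wnorm b) :: rat) = of_int (a * m)" using a0 by (simp add: field_simps)
    thus ?thesis by (simp only: of_int_eq_iff) simp
  qed
  moreover have "real_of_int a \<le> 2 * sqrt (- of_int d)"
  proof -
    \<comment> \<open>The shift brings the real part into \<open>[-1/2, 1/2]\<close>. As
      \<open>s\<close> is no shorter than 1, its imaginary part is at least 1/2; this crude bound is
      the origin of the factor 2 in front of \<open>sqrt (- of_int d)\<close>.\<close>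
    define s where "s = \<tau> - of_int (round (Re \<tau>))"
    have "s \<in> J" unfolding s_def using frac_diff[OF J \<tau>J OJ[OF Od_of_int]] .
    have Ims: "Im s = Im \<omega> / of_int a" 
      using Im_divide_of_real[of "of_int b + \<omega>" "of_int a"] by (simp add: s_def \<tau>_def)
    hence "Im s > 0" using a0 Im_w by simp
    hence "s \<noteq> 0" by auto
    hence "1 \<le> cmod s" using \<open>s \<in> J\<close> short by blast
    hence "1 \<le> (cmod s)\<^sup>2" by simp
    hence 1: "1 \<le> (Re s)\<^sup>2 + (Im s)\<^sup>2" by (simp add: cmod_power2)
    have "\<bar>Re s\<bar> \<le> 1 / 2" using of_int_round_abs_le[of "Re \<tau>"] by (simp add: s_def abs_minus_commute)
    hence "(Re s)\<^sup>2 \<le> (1 / 2)\<^sup>2" by (rule abs_le_square_iff[THEN iffD1, OF order.trans]) simp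
    hence "(1 / 2)\<^sup>2 \<le> (Im s)\<^sup>2" using 1 by (simp add: power2_eq_square)
    hence "1 / 2 \<le> Im s" by (rule power2_le_imp_le) (use \<open>Im s > 0\<close> in simp)
    hence "real_of_int a \<le> 2 * Im \<omega>" using a0 by (simp add: Ims field_simps)
    thus ?thesis using Im_w(2) by linarith
  qed
  moreover have "scale (of_int a) J = quad_ideal a b"
  proof
    show "quad_ideal a b \<subseteq> scale (of_int a) J"
    proof
      fix z assume "z \<in> quad_ideal a b"
      then obtain x y where z: "z = of_int x + of_int y * \<omega>" "a dvd x - b * y" by (auto simp: quad_ideal_def)
      then obtain k where "x - b * y = a * k" by blast
      hence x: "x = b * y + a * k" by simp
      have "z = of_int a * (of_int k + of_int y * \<tau>)" using a0 by (simp add: z x \<tau>_def field_simps)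
      moreover have "of_int k + of_int y * \<tau> \<in> J"
        using fracD(3)[OF J OJ[OF Od_of_int] intJ[OF \<tau>J]] .
      ultimately show "z \<in> scale (of_int a) J" using scaleI by metis
    qed
    show "scale (of_int a) J \<subseteq> quad_ideal a b"
    proof
      fix z assume "z \<in> scale (of_int a) J"
      then obtain x where x: "x \<in> J" "z = of_int a * x" by (auto simp: scale_def)
      then obtain u v where uv: "x = of_rat u + of_rat v * \<omega>" using fracD(1)[OF J] KE by blast
      then obtain m where m: "v = of_int m * v0" using multiple x by blast
      have "x - of_int m * \<tau> \<in> J" using frac_diff[OF J x(1) intJ[OF \<tau>J]] .
      moreover have "x - of_int m * \<tau> = of_rat (u - of_int m * of_int b / of_int a)"
        by (simp add: uv m v0 \<tau>_rat of_rat_diff of_rat_mult of_rat_divide algebra_simps)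
      ultimately have "u - of_int m * of_int b / of_int a \<in> \<int>" using rat by simp
      then obtain k where k: "u - of_int m * of_int b / of_int a = of_int k" by (auto elim: Ints_cases)
      have "x = of_int k + of_int m * \<tau>"
        using \<open>x - of_int m * \<tau> = of_rat (u - of_int m * of_int b / of_int a)\<close>
        by (simp add: k diff_eq_eq)
      hence "z = of_int (a * k + m * b) + of_int m * \<omega>"
        using a0 by (simp add: x(2) \<tau>_def field_simps)
      thus "z \<in> quad_ideal a b" by (simp only: quad_ideal_iff) simp
    qed
  qed
  ultimately show thesis using that a0 b by blast
qed

text \<open>The normal form that serves twice: it makes every fractional ideal invertible and it
  lists representatives of all classes.\<close>

lemma frac_structure:
  assumes J: "fractional_ideal d J"
  obtains c a b where "c \<in> K" "c \<noteq> 0" "a > 0" "0 \<le> b" "b < a" "a dvd wnorm b"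
    "real_of_int a \<le> 2 * sqrt (- of_int d)" "J = scale c (quad_ideal a b)"
proof -
  obtain c where c: "c \<in> J" "c \<noteq> 0" "\<And>x. x \<in> J \<Longrightarrow> x \<noteq> 0 \<Longrightarrow> cmod c \<le> cmod x"
    using frac_shortest[OF J] by blast
  have cK: "c \<in> K" using c(1) fracD(1)[OF J] by blast
  let ?J = "scale (inverse c) J"
  have J': "fractional_ideal d ?J" using scale_frac[OF J K_inverse[OF cK]] c(2) by simp
  have "1 \<in> ?J" using scaleI[OF c(1), of "inverse c"] c(2) by simp
  moreover have "1 \<le> cmod x" if x: "x \<in> ?J" "x \<noteq> 0" for x
  proof -
    obtain y where y: "y \<in> J" "x = inverse c * y" using x(1) by (auto simp: scale_def)
    hence "cmod c \<le> cmod y" using c(3) x(2) by auto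
    thus ?thesis using c(2) by (simp add: y(2) norm_divide field_simps)
  qed
  ultimately obtain a b where ab: "a > 0" "0 \<le> b" "b < a" "a dvd wnorm b"
      "real_of_int a \<le> 2 * sqrt (- of_int d)" "scale (of_int a) ?J = quad_ideal a b"
    using frac_reduced[OF J'] by blast
  have "scale (c / of_int a) (quad_ideal a b) = scale (c / of_int a * of_int a * inverse c) J"
    by (simp only: ab(6)[symmetric] scale_scale mult.assoc)
  also have "\<dots> = J" using ab(1) c(2) by simp
  finally have "J = scale (c / of_int a) (quad_ideal a b)" by simp
  moreover have "c / of_int a \<in> K" "c / of_int a \<noteq> 0" using cK K_of_int K_divide c(2) ab(1) by auto
  ultimately show thesis using that ab by blast
qed

text \<open>For \<open>J = c I\<close> with \<open>I\<close> the lattice of \<open>a\<close> and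
  \<open>b\<close>, the product of \<open>I\<close> and its conjugate is generated by
  \<open>a\<close>; so the inverse of \<open>J\<close> is the conjugate of \<open>I\<close> divided
  by \<open>c * a\<close>.\<close>

lemma frac_inverse:
  assumes "fractional_ideal d J"
  obtains J' where "fractional_ideal d J'" "fprod J' J = Od"
proof -
  obtain c a b where ab: "c \<in> K" "c \<noteq> 0" "a > 0" "a dvd wnorm b" "J = scale c (quad_ideal a b)"
    using frac_structure[OF assms] by metis
  let ?J = "scale (inverse (c * of_int a)) (quad_ideal a (- b - tr_w))"
  have "fractional_ideal d ?J"
    using ab wnorm_conj by (intro scale_frac quad_ideal_frac K_inverse K_mult K_of_int) auto
  moreover have "fprod ?J J = scale (inverse (c * of_int a)) (scale c (fprod (quad_ideal a b) (quad_ideal a (- b - tr_w))))"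
    by (simp only: ab(5) fprod_scale fprod_scale_right scale_scale fprod_comm[of "quad_ideal a (- b - tr_w)"] mult.commute)
  moreover have "\<dots> = scale (inverse (c * of_int a) * (c * of_int a)) Od"
    by (simp only: quad_ideal_mult_conj[OF ab(3,4)] scale_scale mult.assoc)
  moreover have "inverse (c * of_int a) * (c * of_int a) = 1"
    by (rule left_inverse) (use ab(2,3) in simp)
  ultimately show thesis using that by (metis scale_1)
qed

section \<open>The group of fractional ideals and its class group\<close>

lemma IG_comm_group: "comm_group IG"
proof (rule comm_groupI)
  fix x assume "x \<in> carrier IG"
  hence "fractional_ideal d x" by simp
  then obtain y where "fractional_ideal d y" "fprod y x = Od" by (rule frac_inverse)
  thus "\<exists>y\<in>carrier IG. y \<otimes>\<^bsub>IG\<^esub> x = \<one>\<^bsub>IG\<^esub>" by (intro bexI[of _ y]) simp_all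
next
  show "x \<otimes>\<^bsub>IG\<^esub> y = y \<otimes>\<^bsub>IG\<^esub> x" for x y using fprod_comm by simp
qed (simp_all add: fprod_frac Od_frac fprod_assoc frac_fprod_Od)

sublocale IG: comm_group IG by (rule IG_comm_group)

lemma scale_Od_mult: "fprod (scale c Od) (scale c' Od) = scale (c * c') Od"
  using frac_fprod_Od[OF Od_frac] by (simp add: fprod_scale fprod_scale_right scale_scale mult.commute)

lemma PG_subgroup: "subgroup PG IG"
proof (rule IG.subgroupI)
  show "PG \<subseteq> carrier IG" using scale_frac[OF Od_frac] by (auto elim!: PG_E)
  have "scale 1 Od \<in> PG" using PG_I[OF K_1] by simp
  thus "PG \<noteq> {}" by blast
  fix I J assume "I \<in> PG" "J \<in> PG"
  then obtain c c' where c: "c \<in> K" "c \<noteq> 0" "I = scale c Od" and c': "c' \<in> K" "c' \<noteq> 0" "J = scale c' Od"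
    by (elim PG_E)
  have "I \<otimes>\<^bsub>IG\<^esub> J = scale (c * c') Od" by (simp add: c c' scale_Od_mult)
  thus "I \<otimes>\<^bsub>IG\<^esub> J \<in> PG" using PG_I[of "c * c'"] c(1,2) c'(1,2) K_mult by simp
next
  fix I assume "I \<in> PG"
  then obtain c where c: "c \<in> K" "c \<noteq> 0" "I = scale c Od" by (elim PG_E)
  have "fprod (scale (inverse c) Od) I = Od" using c by (simp add: scale_Od_mult)
  hence "inv\<^bsub>IG\<^esub> I = scale (inverse c) Od"
    using c scale_frac[OF Od_frac, of c] scale_frac[OF Od_frac K_inverse, of c]
    by (intro IG.inv_equality) simp_all
  thus "inv\<^bsub>IG\<^esub> I \<in> PG" using PG_I[OF K_inverse, of c] c(1,2) by simp
qed

sublocale PG: normal PG IG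
  by (rule IG.subgroup_imp_normal[OF PG_subgroup])

abbreviation "CG \<equiv> class_group d"

lemma CG_comm_group: "comm_group CG"
  unfolding class_group_def using IG.abelian_FactGroup PG_subgroup by blast

sublocale CG: comm_group CG by (rule CG_comm_group)

definition cls :: "complex set \<Rightarrow> complex set set" where "cls J = PG #>\<^bsub>IG\<^esub> J"

lemma cls_hom: "group_hom IG CG cls"
proof -
  have "cls \<in> hom IG CG"
    using PG.r_coset_hom_Mod unfolding class_group_def cls_def by (simp add: eta_contract_eq)
  thus ?thesis 
    by (intro group_hom.intro group_hom_axioms.intro IG.is_group CG.is_group)
qed

sublocale cls: group_hom IG CG cls by (rule cls_hom)

lemma carrier_CG: "carrier CG = cls ` carrier IG"
  by (auto simp: class_group_def FactGroup_def RCOSETS_def cls_def)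

lemma one_CG: "\<one>\<^bsub>CG\<^esub> = PG" by (simp add: class_group_def FactGroup_def)

lemma cls_eq_one_iff: "fractional_ideal d J \<Longrightarrow> cls J = \<one>\<^bsub>CG\<^esub> \<longleftrightarrow> J \<in> PG"
  by (metis IG.coset_join1 IG.coset_join2 PG_subgroup cls_def fractional_ideal_group_sel(3) one_CG
      subgroup.subset)

lemma cls_scale:
  assumes "fractional_ideal d J" "c \<in> K" "c \<noteq> 0" shows "cls (scale c J) = cls J"
proof -
  have f: "fractional_ideal d (scale c Od)" using scale_frac Od_frac assms by blast
  have "scale c J = fprod (scale c Od) J" using frac_fprod_Od[OF assms(1)] by (simp add: fprod_scale)
  hence "cls (scale c J) = cls (scale c Od) \<otimes>\<^bsub>CG\<^esub> cls J" using cls.hom_mult[of "scale c Od" J] assms f by simp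
  also have "cls (scale c Od) = \<one>\<^bsub>CG\<^esub>" using cls_eq_one_iff[OF f] PG_I assms(2,3) by blast
  finally show ?thesis using cls.hom_closed[of J] assms by simp
qed

end

subsection \<open>The class number bound\<close>

text \<open>The inequality \<open>ln x \<le> x - 1\<close> at \<open>x = n / (n + 1)\<close> bounds
  each new term by an increment of the logarithm.\<close>

lemma harmonic_le:
  assumes "n \<ge> 1" shows "(\<Sum>k=1..n. 1 / real k) \<le> 1 + ln (real n)"
  using assms
proof (induction n rule: dec_induct)
  case (step n)
  have "ln (real n / real (Suc n)) \<le> real n / real (Suc n) - 1"
    using step by (intro ln_le_minus_one) auto
  also have "\<dots> = - (1 / real (Suc n))" by (simp add: field_simps)
  finally have "1 / real (Suc n) \<le> ln (real (Suc n)) - ln (real n)"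
    using step by (simp add: ln_div)
  thus ?case using step by simp
qed simp

text \<open>Exchanging the summations, each \<open>k\<close> divides at most \<open>N div k\<close>
  of the numbers up to \<open>N\<close>, which leaves \<open>N\<close> times a harmonic sum.\<close>

lemma sum_card_divisors_le:
  assumes "N \<ge> 1"
  shows "real (\<Sum>a=1..N. card {k::nat. k dvd a}) \<le> real N * (1 + ln (real N))"
proof -
  have "(\<Sum>a=1..N. card {k. k dvd a}) = (\<Sum>a=1..N. card {k\<in>{1..N}. k dvd a})"
  proof (rule sum.cong[OF refl])
    fix a assume a: "a \<in> {1..N}"
    have "k \<in> {1..N}" if "k dvd a" for k
      using that a dvd_imp_le[of k a] dvd_pos_nat[of a k] by auto
    hence "{k. k dvd a} = {k\<in>{1..N}. k dvd a}" by blast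
    thus "card {k. k dvd a} = card {k\<in>{1..N}. k dvd a}" by simp
  qed
  also have "\<dots> = (\<Sum>a=1..N. \<Sum>k=1..N. if k dvd a then 1 else 0)"
    by (simp add: sum.If_cases Int_def)
  also have "\<dots> = (\<Sum>k=1..N. \<Sum>a=1..N. if k dvd a then 1 else 0)" by (rule sum.swap)
  also have "\<dots> = (\<Sum>k=1..N. card {a\<in>{1..N}. k dvd a})"
    by (simp add: sum.If_cases Int_def)
  also have "\<dots> \<le> (\<Sum>k=1..N. N div k)"
  proof (rule sum_mono)
    fix k assume k: "k \<in> {1..N}"
    have "{a\<in>{1..N}. k dvd a} \<subseteq> (*) k ` {1..N div k}"
    proof
      fix a assume "a \<in> {a\<in>{1..N}. k dvd a}"
      then obtain j where "a = k * j" "1 \<le> k * j" "k * j \<le> N" by auto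
      moreover from this have "j \<le> N div k" using k by (simp add: less_eq_div_iff_mult_less_eq mult.commute)
      ultimately show "a \<in> (*) k ` {1..N div k}" by (cases "j = 0") auto
    qed
    hence "card {a\<in>{1..N}. k dvd a} \<le> card {1..N div k}" by (rule surj_card_le[rotated]) simp
    thus "card {a\<in>{1..N}. k dvd a} \<le> N div k" by simp
  qed
  finally have "real (\<Sum>a=1..N. card {k. k dvd a}) \<le> real (\<Sum>k=1..N. N div k)" by (simp only: of_nat_le_iff)
  also have "\<dots> \<le> (\<Sum>k=1..N. real N * (1 / real k))"
    unfolding of_nat_sum by (intro sum_mono) (simp add: of_nat_div_le_of_nat)
  also have "\<dots> = real N * (\<Sum>k=1..N. 1 / real k)" by (simp only: sum_distrib_left)
  also have "\<dots> \<le> real N * (1 + ln (real N))" using harmonic_le[OF assms] by (intro mult_left_mono) auto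
  finally show ?thesis .
qed

context imag_quad
begin

text \<open>Fixing a root \<open>b\<^sub>0\<close> modulo \<open>a\<close>, any other root \<open>b\<close> satisfies
  \<open>a dvd (b - b\<^sub>0) * (b + b\<^sub>0 + tr_w)\<close>, so it is congruent to \<open>b\<^sub>0\<close> modulo \<open>g = gcd a (b - b\<^sub>0)\<close> and to
  the conjugate root modulo \<open>a / g\<close>; these two moduli are coprime since there are no double roots.\<close>

lemma card_roots_le_divisors:
  assumes a: "a > 0"
  shows "card {b. 0 \<le> b \<and> b < int a \<and> int a dvd wnorm b} \<le> card {k::nat. k dvd a}"
proof (cases "{b. 0 \<le> b \<and> b < int a \<and> int a dvd wnorm b} = {}")
  case False
  let ?R = "{b. 0 \<le> b \<and> b < int a \<and> int a dvd wnorm b}"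
  obtain b0 where b0: "int a dvd wnorm b0" using False by blast
  let ?g = "\<lambda>b. gcd (int a) (b - b0)"
  have split: "\<exists>h. int a = ?g b * h \<and> h dvd b + b0 + tr_w \<and> coprime (?g b) h" if b: "int a dvd wnorm b" for b
  proof -
    let ?G = "?g b"
    obtain h where h: "int a = ?G * h" by (meson dvdE gcd_dvd1)
    obtain m where m: "b - b0 = ?G * m" by (meson dvdE gcd_dvd2)
    have G0: "?G > 0" using a by simp
    have "?G * gcd h m = gcd (?G * h) (?G * m)" using G0 by (simp add: gcd_mult_distrib_int[symmetric])
    also have "\<dots> = ?G" using h m by simp
    finally have "coprime h m" using a by (auto simp: coprime_iff_gcd_eq_1)
    have "int a dvd wnorm b - wnorm b0" using b b0 by (rule dvd_diff)
    also have "wnorm b - wnorm b0 = (b - b0) * (b + b0 + tr_w)" by (simp add: wnorm_def power2_eq_square algebra_simps)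
    finally have "?G * h dvd ?G * (m * (b + b0 + tr_w))" using h m by (metis mult.assoc)
    hence "h dvd m * (b + b0 + tr_w)" using a by auto
    hence hd: "h dvd b + b0 + tr_w" using \<open>coprime h m\<close> coprime_dvd_mult_right_iff by blast
    have "gcd ?G h = 1"
    proof (rule ccontr)
      let ?p = "gcd ?G h"
      assume "?p \<noteq> 1"
      moreover have "?p > 0" using G0 by (simp add: gcd_pos_int)
      ultimately have "?p > 1" by linarith
      \<comment> \<open>A common factor of both moduli divides \<open>b - b0\<close> and
        \<open>b + b0 + tr_w\<close>, hence their difference. Its square divides
        \<open>int a\<close>, so \<open>b0\<close> would be a forbidden double root.\<close>
      moreover have "?p dvd 2 * b0 + tr_w"
      proof -
        have "?p dvd b - b0" by (metis dvd_trans gcd_dvd1 gcd_dvd2)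
        moreover have "?p dvd b + b0 + tr_w" using hd by (metis dvd_trans gcd_dvd2)
        ultimately have "?p dvd (b + b0 + tr_w) - (b - b0)" by (rule dvd_diff[rotated])
        thus ?thesis by (simp add: algebra_simps)
      qed
      moreover have "?p\<^sup>2 dvd wnorm b0"
      proof -
        have "?p * ?p dvd ?G * h" by (intro mult_dvd_mono gcd_dvd1 gcd_dvd2)
        hence "?p\<^sup>2 dvd int a" by (simp only: h[symmetric] power2_eq_square)
        thus ?thesis using b0 by (rule dvd_trans)
      qed
      ultimately show False using wnorm_no_double_root by blast
    qed
    thus ?thesis using h hd coprime_iff_gcd_eq_1 by blast
  qed
  \<comment> \<open>Equal gcds have equal cofactors \<open>h\<close>. Two such roots agree modulo
    the gcd and modulo \<open>h\<close>, which are coprime, and so modulo their product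
    \<open>int a\<close>.\<close>
  have "inj_on (\<lambda>b. nat (?g b)) ?R"
  proof (rule inj_onI)
    fix b b' assume b: "b \<in> ?R" and b': "b' \<in> ?R" and "nat (?g b) = nat (?g b')"
    hence eq: "?g b = ?g b'" by (simp add: eq_nat_nat_iff)
    obtain h where h: "int a = ?g b * h" "h dvd b + b0 + tr_w" "coprime (?g b) h" using split b by blast
    obtain h' where h': "int a = ?g b' * h'" "h' dvd b' + b0 + tr_w" using split b' by blast
    have "?g b \<noteq> 0" using a by simp
    moreover have "?g b * h' = ?g b * h" using h(1) h'(1) eq by (simp only:)
    ultimately have "h' = h" by (simp only: mult_cancel_left) simp
    hence "h dvd (b + b0 + tr_w) - (b' + b0 + tr_w)" using h(2) h'(2) by (intro dvd_diff) auto
    hence "h dvd b - b'" by simp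
    moreover have "?g b dvd (b - b0) - (b' - b0)" using eq by (metis dvd_diff gcd_dvd2)
    hence "?g b dvd b - b'" by simp
    ultimately have "?g b * h dvd b - b'" using h(3) by (simp add: divides_mult)
    hence "int a dvd b - b'" by (simp only: h(1)[symmetric])
    hence "b mod int a = b' mod int a" by (simp add: mod_eq_dvd_iff)
    thus "b = b'" using b b' by simp
  qed
  moreover have "(\<lambda>b. nat (?g b)) ` ?R \<subseteq> {k. k dvd a}"
    by (auto simp: nat_dvd_iff)
  moreover have "finite {k. k dvd a}" using a by simp
  ultimately show ?thesis by (rule card_inj_on_le)
qed (simp only: card.empty)

lemma class_number_bound:
  "finite (carrier CG)" "real (card (carrier CG)) \<le> 7 * sqrt (- of_int d) * ln (- of_int d)"
proof -
  define D where "D = - real_of_int d"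
  define N where "N = nat \<lfloor>2 * sqrt D\<rfloor>"
  define R where "R a = {b. 0 \<le> b \<and> b < int a \<and> int a dvd wnorm b}" for a :: nat
  have finR: "finite (R a)" for a by (rule finite_subset[of _ "{0..<int a}"]) (auto simp: R_def)
  have D2: "D \<ge> 2" using dneg by (simp add: D_def)
  have sub: "carrier CG \<subseteq> (\<lambda>(a, b). cls (quad_ideal (int a) b)) ` (SIGMA a:{1..N}. R a)"
  proof
    fix x assume "x \<in> carrier CG"
    then obtain J where J: "fractional_ideal d J" "x = cls J" by (auto simp: carrier_CG)
    obtain c a b where ab: "c \<in> K" "c \<noteq> 0" "a > 0" "0 \<le> b" "b < a" "a dvd wnorm b"
      "real_of_int a \<le> 2 * sqrt (- of_int d)" "J = scale c (quad_ideal a b)"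
      using frac_structure[OF J(1)] by metis
    have "x = cls (quad_ideal a b)" using J(2) ab cls_scale[OF quad_ideal_frac, of a b c] by simp
    moreover have "a \<le> \<lfloor>2 * sqrt D\<rfloor>" using ab(7) by (simp add: D_def le_floor_iff)
    hence "nat a \<in> {1..N}" using ab(3) nat_mono[OF \<open>a \<le> \<lfloor>2 * sqrt D\<rfloor>\<close>] by (simp add: N_def Suc_le_eq)
    moreover have "b \<in> R (nat a)" using ab by (simp add: R_def)
    ultimately show "x \<in> (\<lambda>(a, b). cls (quad_ideal (int a) b)) ` (SIGMA a:{1..N}. R a)"
      using ab(3) by (intro image_eqI[of _ _ "(nat a, b)"]) auto
  qed
  have fin: "finite (SIGMA a:{1..N}. R a)" using finR by blast
  thus "finite (carrier CG)" using sub finite_surj by blast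
  have "1 \<le> sqrt D" using D2 by simp
  hence N1: "N \<ge> 1" unfolding N_def by linarith
  have N2: "real N \<le> 2 * sqrt D" unfolding N_def using \<open>1 \<le> sqrt D\<close> by linarith
  have "card (carrier CG) \<le> card (SIGMA a:{1..N}. R a)" using surj_card_le[OF fin sub] .
  also have "\<dots> = (\<Sum>a=1..N. card (R a))" using finR by (simp add: card_SigmaI)
  also have "\<dots> \<le> (\<Sum>a=1..N. card {k::nat. k dvd a})"
    unfolding R_def by (intro sum_mono card_roots_le_divisors) auto
  finally have "real (card (carrier CG)) \<le> real (\<Sum>a=1..N. card {k::nat. k dvd a})" by (simp only: of_nat_le_iff)
  also have "\<dots> \<le> real N * (1 + ln (real N))" by (rule sum_card_divisors_le[OF N1])
  also have "\<dots> \<le> 2 * sqrt D * (1 + ln (2 * sqrt D))"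
  proof (intro mult_mono add_left_mono)
    show "ln (real N) \<le> ln (2 * sqrt D)" using N1 N2 by (intro ln_mono) auto
  qed (use N1 N2 D2 in auto)
  also have "ln (2 * sqrt D) = ln 2 + ln D / 2" using D2 by (simp add: ln_mult ln_sqrt)
  \<comment> \<open>From \<open>1 \<le> 2 * ln 2\<close> and \<open>D \<ge> 2\<close> the bracket is
    at most \<open>(2 + 1 + 1/2) * ln D\<close>. Doubling \<open>7 / 2\<close> gives the constant
    7.\<close>
  also have "2 * sqrt D * (1 + (ln 2 + ln D / 2)) \<le> 2 * sqrt D * (7 / 2 * ln D)"
  proof (rule mult_left_mono)
    have "1 = ln (exp 1 :: real)" by simp
    also have "\<dots> \<le> ln (2 * 2)" using exp_le by (subst ln_le_cancel_iff) auto
    also have "\<dots> = 2 * ln (2 :: real)" by (subst ln_mult) auto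
    finally have "1 \<le> 2 * ln (2 :: real)" .
    moreover have "ln 2 \<le> ln D" using D2 by simp
    ultimately show "1 + (ln 2 + ln D / 2) \<le> 7 / 2 * ln D" by linarith
  qed (use D2 in simp)
  finally show "real (card (carrier CG)) \<le> 7 * sqrt (- of_int d) * ln (- of_int d)"
    by (simp add: D_def)
qed

end

subsection \<open>Prime ideals\<close>

context imag_quad
begin

section \<open>The ring of integers as an abstract ring: ideals and cosets\<close>

lemma cring_Od: "cring (quad_integers d)"
proof (rule cringI)
  show "abelian_group (quad_integers d)"
  proof (rule abelian_groupI)
    fix x assume "x \<in> Od"
    thus "\<exists>y\<in>Od. y \<oplus>\<^bsub>quad_integers d\<^esub> x = \<zero>\<^bsub>quad_integers d\<^esub>"
      using Od_uminus by (intro bexI[of _ "- x"]) simp_all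
  qed (simp_all add: Od_add Od_0)
  show "comm_monoid (quad_integers d)"
    by (rule comm_monoidI) (simp_all add: Od_mult Od_1)
qed (simp add: distrib_right)

sublocale Od: cring "quad_integers d" by (rule cring_Od)

lemma ideal_OdD:
  assumes "ideal I (quad_integers d)"
  shows "I \<subseteq> Od" "0 \<in> I" "x \<in> I \<Longrightarrow> y \<in> I \<Longrightarrow> x + y \<in> I" "a \<in> Od \<Longrightarrow> x \<in> I \<Longrightarrow> a * x \<in> I"
proof -
  interpret ideal I "quad_integers d" by fact
  show "I \<subseteq> Od" "0 \<in> I" "x \<in> I \<Longrightarrow> y \<in> I \<Longrightarrow> x + y \<in> I" "a \<in> Od \<Longrightarrow> x \<in> I \<Longrightarrow> a * x \<in> I"
    using a_subset zero_closed a_closed[of x y] I_l_closed[of x a] by simp_all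
qed

lemma Od_ideal_diff:
  assumes "ideal I (quad_integers d)" "x \<in> I" "y \<in> I" shows "x - y \<in> I"
  using ideal_OdD(3)[OF assms(1,2) ideal_OdD(4)[OF assms(1) Od_of_int[of "-1"] assms(3)]] by simp

lemma Od_coset: "I +>\<^bsub>quad_integers d\<^esub> x = (\<lambda>h. h + x) ` I"
  by (auto simp: a_r_coset_def r_coset_def)

lemma Od_coset_eq_iff:
  assumes I: "ideal I (quad_integers d)"
  shows "I +>\<^bsub>quad_integers d\<^esub> x = I +>\<^bsub>quad_integers d\<^esub> y \<longleftrightarrow> x - y \<in> I"
proof
  assume "I +>\<^bsub>quad_integers d\<^esub> x = I +>\<^bsub>quad_integers d\<^esub> y"
  moreover have "0 + x \<in> (\<lambda>h. h + x) ` I" using ideal_OdD(2)[OF I] by (rule imageI)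
  ultimately have "0 + x \<in> (\<lambda>h. h + y) ` I" by (simp only: Od_coset)
  then obtain h where "h \<in> I" "x = h + y" by auto
  thus "x - y \<in> I" by simp
next
  have sub: "(\<lambda>h. h + x) ` I \<subseteq> (\<lambda>h. h + y) ` I" if "x - y \<in> I" for x y
  proof
    fix z assume "z \<in> (\<lambda>h. h + x) ` I"
    then obtain h where h: "h \<in> I" "z = h + x" by auto
    hence "z = (h + (x - y)) + y" by simp
    moreover have "h + (x - y) \<in> I" using ideal_OdD(3)[OF I h(1) that] .
    ultimately show "z \<in> (\<lambda>h. h + y) ` I" by blast
  qed
  assume xy: "x - y \<in> I"
  have "y - x \<in> I" using Od_ideal_diff[OF I ideal_OdD(2)[OF I] xy] by simp
  thus "I +>\<^bsub>quad_integers d\<^esub> x = I +>\<^bsub>quad_integers d\<^esub> y"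
    using sub[OF xy] sub[of y x] by (simp only: Od_coset) blast
qed

lemma carrier_Quot: "carrier (quad_integers d Quot I) = (\<lambda>x. I +>\<^bsub>quad_integers d\<^esub> x) ` Od"
  by (auto simp: FactRing_def A_RCOSETS_def RCOSETS_def a_r_coset_def)

text \<open>The norm of a nonzero element is a positive integer in \<open>P\<close>. Take the least
  positive integer \<open>m\<close> in \<open>P\<close> and a prime factor of it: the cofactor is
  smaller, hence outside \<open>P\<close>, so primality puts the prime factor inside.\<close>

lemma prime_in_primeideal:
  assumes P: "primeideal P (quad_integers d)" and nz: "P \<noteq> {0}"
  obtains p :: nat where "Factorial_Ring.prime p" "of_nat p \<in> P"
proof -
  interpret primeideal P "quad_integers d" by fact
  note primeD = ideal_OdD[OF is_ideal]
  have one: "1 \<notin> P" using I_notcarr primeD(4)[of _ 1] primeD(1) by auto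
  obtain x where x: "x \<in> P" "x \<noteq> 0" using nz primeD(2) by blast
  hence xO: "x \<in> Od" using primeD(1) by blast
  obtain N where N: "(cmod x)\<^sup>2 = of_int N" using cmod_sq_int[OF xO] by (auto elim: Ints_cases)
  have "(cmod x)\<^sup>2 > 0" using x(2) by simp
  hence N0: "N > 0" by (simp add: N)
  have "cnj x * x = of_int N" using N by (metis complex_norm_square mult.commute of_real_of_int_eq)
  hence "of_int N \<in> P" using primeD(4)[OF Od_cnj[OF xO] x(1)] by simp
  hence ex: "nat N > 0 \<and> of_nat (nat N) \<in> P" using N0 by simp
  define m where "m = (LEAST m::nat. m > 0 \<and> of_nat m \<in> P)"
  have m: "m > 0" "of_nat m \<in> P" using LeastI[of "\<lambda>m. m > 0 \<and> of_nat m \<in> P", OF ex] unfolding m_def by auto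
  have least: "m \<le> k" if "k > 0" "of_nat k \<in> P" for k
    unfolding m_def using that by (intro Least_le) auto
  have "m \<noteq> 1" using m(2) one by auto
  then obtain p k where p: "Factorial_Ring.prime p" "m = p * k"
    using prime_factor_nat[of m] by (metis dvdE)
  have "k > 0" using m(1) p(2) by (cases k) auto
  have "(of_nat p * of_nat k :: complex) \<in> P" using m(2) p(2) by simp
  moreover have "of_nat p \<in> Od" "of_nat k \<in> Od" using Od_of_int[of "int p"] Od_of_int[of "int k"] by auto
  ultimately have "of_nat p \<in> P \<or> of_nat k \<in> P" using I_prime[of "of_nat p" "of_nat k"] by simp
  moreover have "of_nat k \<notin> P"
  proof
    assume "of_nat k \<in> P"
    hence "m \<le> k" using least \<open>k > 0\<close> by blast
    moreover have "k < p * k" using \<open>k > 0\<close> prime_gt_1_nat[OF p(1)] by simp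
    ultimately show False using p(2) by simp
  qed
  ultimately show thesis using that p(1) by blast
qed

section \<open>A prime ideal above a given rational prime\<close>

context
  fixes P :: "complex set" and p :: nat
  assumes P: "primeideal P (quad_integers d)" and p: "Factorial_Ring.prime p" and pP: "of_nat p \<in> P"
begin

interpretation P: primeideal P "quad_integers d" by (rule P)

lemmas primeD = ideal_OdD[OF P.is_ideal]

lemma one_notin_prime: "1 \<notin> P" using P.I_notcarr primeD(4)[of _ 1] primeD(1) by auto

lemma prime_int_mem_iff: "of_int k \<in> P \<longleftrightarrow> int p dvd k"
proof
  assume k: "of_int k \<in> P"
  show "int p dvd k"
  proof (rule ccontr)
    assume "\<not> int p dvd k"
    hence "coprime (int p) k" using p by (simp add: prime_imp_coprime)
    then obtain u v where uv: "u * int p + v * k = 1" using bezout_int[of "int p" k] by auto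
    have "of_int u * of_int (int p) + of_int v * of_int k \<in> P"
      using primeD(3)[OF primeD(4)[OF Od_of_int] primeD(4)[OF Od_of_int k]] pP by simp
    hence "of_int (u * int p + v * k) \<in> P" by simp
    thus False using one_notin_prime by (simp only: uv) simp
  qed
next
  assume "int p dvd k"
  then obtain m where "k = int p * m" by blast
  thus "of_int k \<in> P" using primeD(4)[OF Od_of_int[of m] pP] by (simp add: mult.commute)
qed

lemma prime_below_eq: "prime_below P = p"
  unfolding prime_below_def
proof (rule the_equality)
  fix q :: nat assume q: "Factorial_Ring.prime q \<and> of_nat q \<in> P"
  hence "of_int (int q) \<in> P" by simp
  hence "p dvd q" unfolding prime_int_mem_iff by simp
  thus "q = p" using p q primes_dvd_imp_eq by blast
qed (use p pP in simp)

text \<open>If some element has its \<open>\<omega>\<close>-coordinate prime to \<open>p\<close>,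
  Bezout normalises that coordinate to 1, using that \<open>p * \<omega>\<close> is in
  \<open>P\<close>; the resulting \<open>b + \<omega>\<close> together with \<open>p\<close>
  determines \<open>P\<close>. Otherwise \<open>p\<close> divides both coordinates of every element.
  The lattice case covers split and ramified primes alike.\<close>

lemma prime_dichotomy: "P = scale (of_nat p) Od \<or> (\<exists>b. P = quad_ideal (int p) b \<and> int p dvd wnorm b)"
proof (cases "\<exists>x y. of_int x + of_int y * \<omega> \<in> P \<and> \<not> int p dvd y")
  case True
  then obtain x y where xy: "of_int x + of_int y * \<omega> \<in> P" "\<not> int p dvd y" by blast
  hence "coprime (int p) y" using p by (simp add: prime_imp_coprime)
  hence "coprime y (int p)" by (simp only: coprime_commute)
  then obtain u v where uv: "u * y + v * int p = 1" using bezout_int[of y "int p"] by auto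
  define b where "b = u * x"
  have "of_int u * (of_int x + of_int y * \<omega>) + (of_int v * \<omega>) * of_nat p \<in> P"
    using primeD(3)[OF primeD(4)[OF Od_of_int xy(1)] primeD(4)[OF Od_mult[OF Od_of_int Od_w] pP]] .
  also have "of_int u * (of_int x + of_int y * \<omega>) + (of_int v * \<omega>) * of_nat p
      = of_int b + of_int (u * y + v * int p) * \<omega>" by (simp add: b_def algebra_simps)
  finally have bP: "of_int b + \<omega> \<in> P" by (simp add: uv)
  have mem: "of_int x + of_int y * \<omega> \<in> P \<longleftrightarrow> int p dvd x - b * y" for x y
  proof -
    have e: "of_int x + of_int y * \<omega> = of_int (x - b * y) + of_int y * (of_int b + \<omega>)"
      by (simp add: algebra_simps)
    have y: "of_int y * (of_int b + \<omega>) \<in> P" using primeD(4)[OF Od_of_int bP] .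
    have "of_int x + of_int y * \<omega> \<in> P \<longleftrightarrow> of_int (x - b * y) \<in> P"
    proof
      assume "of_int x + of_int y * \<omega> \<in> P"
      from Od_ideal_diff[OF P.is_ideal this y] show "of_int (x - b * y) \<in> P" by (simp only: e) simp
    next
      assume "of_int (x - b * y) \<in> P"
      thus "of_int x + of_int y * \<omega> \<in> P" unfolding e using y by (rule primeD(3))
    qed
    thus ?thesis by (simp only: prime_int_mem_iff)
  qed
  have "P = quad_ideal (int p) b"
  proof (intro equalityI subsetI)
    fix z assume z: "z \<in> P"
    then obtain x y where "z = of_int x + of_int y * \<omega>" using primeD(1) by (meson Od_E subsetD)
    thus "z \<in> quad_ideal (int p) b" using z by (simp only: mem quad_ideal_iff)
  next
    fix z assume "z \<in> quad_ideal (int p) b"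
    thus "z \<in> P" unfolding quad_ideal_def using mem by blast
  qed
  moreover have "int p dvd wnorm b"
  proof -
    have "of_int b + \<omega> \<in> Od" using bP primeD(1) by blast
    from primeD(4)[OF Od_cnj[OF this] bP] have "(of_int b + \<omega>) * cnj (of_int b + \<omega>) \<in> P"
      by (simp only: mult.commute)
    thus ?thesis by (simp only: wnorm_norm prime_int_mem_iff)
  qed
  ultimately show ?thesis by blast
next
  case False
  have "P = scale (of_nat p) Od"
  proof (intro equalityI subsetI)
    fix z assume z: "z \<in> P"
    then obtain x y where xy: "z = of_int x + of_int y * \<omega>" using primeD(1) by (meson Od_E subsetD)
    hence "int p dvd y" using False z by blast
    then obtain k where k: "y = int p * k" by blast
    have "z - (of_int k * \<omega>) * of_nat p \<in> P"
      using Od_ideal_diff[OF P.is_ideal z primeD(4)[OF Od_mult[OF Od_of_int Od_w] pP]] .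
    hence "of_int x \<in> P" by (simp add: xy k mult_ac)
    hence "int p dvd x" by (simp only: prime_int_mem_iff)
    then obtain m where m: "x = int p * m" by blast
    have "z = of_nat p * (of_int m + of_int k * \<omega>)" by (simp add: xy k m algebra_simps)
    thus "z \<in> scale (of_nat p) Od" using scaleI[OF w_lin_integral] by metis
  next
    fix z assume "z \<in> scale (of_nat p) Od"
    then obtain y where "y \<in> Od" "z = of_nat p * y" by (auto simp: scale_def)
    thus "z \<in> P" using primeD(4)[OF _ pP, of y] by (simp add: mult.commute)
  qed
  thus ?thesis by blast
qed

section \<open>The residue field over its prime field\<close>

abbreviation "QR \<equiv> quad_integers d Quot P"
abbreviation "cs x \<equiv> P +>\<^bsub>quad_integers d\<^esub> x"
abbreviation "PF \<equiv> range (\<lambda>k::int. cs (of_int k))"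

lemma cs_mult: "x \<in> Od \<Longrightarrow> y \<in> Od \<Longrightarrow> cs x \<otimes>\<^bsub>QR\<^esub> cs y = cs (x * y)"
  and cs_add: "x \<in> Od \<Longrightarrow> y \<in> Od \<Longrightarrow> cs x \<oplus>\<^bsub>QR\<^esub> cs y = cs (x + y)"
  and cs_one: "\<one>\<^bsub>QR\<^esub> = cs 1"
  and cs_closed: "x \<in> Od \<Longrightarrow> cs x \<in> carrier QR"
  using ring_hom_mult[OF P.rcos_ring_hom, of x y] ring_hom_add[OF P.rcos_ring_hom, of x y]
    ring_hom_one[OF P.rcos_ring_hom] ring_hom_closed[OF P.rcos_ring_hom, of x] by simp_all

lemma cs_zero: "\<zero>\<^bsub>QR\<^esub> = cs 0"
  by (simp add: FactRing_def Od_coset)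

interpretation QR: domain QR by (rule P.quotient_is_domain)

text \<open>Dimensions are unique over a subfield, and \<open>residue_degree\<close> is a definite
  description that relies on this uniqueness. Inverses come from Bezout modulo
  \<open>p\<close>.\<close>

lemma prime_field_subfield: "subfield PF QR"
proof (rule QR.subfieldI)
  have PFc: "PF \<subseteq> carrier QR" using cs_closed Od_of_int by auto
  have "subring PF QR"
  proof (rule QR.subringI[OF PFc])
    show "\<one>\<^bsub>QR\<^esub> \<in> PF" by (rule image_eqI[of _ _ 1]) (simp_all add: cs_one)
  next
    fix h assume "h \<in> PF"
    then obtain k where k: "h = cs (of_int k)" by blast
    have "cs (of_int (- k)) \<oplus>\<^bsub>QR\<^esub> h = \<zero>\<^bsub>QR\<^esub>"
      unfolding k cs_add[OF Od_of_int Od_of_int] cs_zero by simp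
    hence "\<ominus>\<^bsub>QR\<^esub> h = cs (of_int (- k))"
      using k cs_closed[OF Od_of_int] by (intro QR.minus_equality) blast+
    thus "\<ominus>\<^bsub>QR\<^esub> h \<in> PF" by (rule image_eqI) simp
  next
    fix h1 h2 assume "h1 \<in> PF" "h2 \<in> PF"
    then obtain k1 k2 where "h1 = cs (of_int k1)" "h2 = cs (of_int k2)" by blast
    hence "h1 \<otimes>\<^bsub>QR\<^esub> h2 = cs (of_int (k1 * k2))" "h1 \<oplus>\<^bsub>QR\<^esub> h2 = cs (of_int (k1 + k2))"
      by (simp_all add: cs_mult cs_add Od_of_int)
    thus "h1 \<otimes>\<^bsub>QR\<^esub> h2 \<in> PF" "h1 \<oplus>\<^bsub>QR\<^esub> h2 \<in> PF" by (auto simp del: of_int_mult of_int_add)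
  qed
  thus "subcring PF QR" by (rule QR.subcringI')
  show "Units (QR\<lparr>carrier := PF\<rparr>) = PF - {\<zero>\<^bsub>QR\<^esub>}"
  proof
    show "Units (QR\<lparr>carrier := PF\<rparr>) \<subseteq> PF - {\<zero>\<^bsub>QR\<^esub>}"
    proof
      fix y assume "y \<in> Units (QR\<lparr>carrier := PF\<rparr>)"
      then obtain x where "y \<in> PF" "x \<in> PF" "x \<otimes>\<^bsub>QR\<^esub> y = \<one>\<^bsub>QR\<^esub>" by (auto simp: Units_def)
      moreover have "y \<noteq> \<zero>\<^bsub>QR\<^esub>"
      proof
        assume "y = \<zero>\<^bsub>QR\<^esub>"
        moreover have "x \<in> carrier QR" using PFc \<open>x \<in> PF\<close> by blast
        ultimately show False using \<open>x \<otimes>\<^bsub>QR\<^esub> y = \<one>\<^bsub>QR\<^esub>\<close> by simp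
      qed
      ultimately show "y \<in> PF - {\<zero>\<^bsub>QR\<^esub>}" by blast
    qed
    show "PF - {\<zero>\<^bsub>QR\<^esub>} \<subseteq> Units (QR\<lparr>carrier := PF\<rparr>)"
    proof
      fix y assume y: "y \<in> PF - {\<zero>\<^bsub>QR\<^esub>}"
      then obtain k where k: "y = cs (of_int k)" by blast
      have "of_int k \<notin> P"
        using y Od_coset_eq_iff[OF P.is_ideal, of "of_int k" 0] by (simp add: k cs_zero)
      hence "\<not> int p dvd k" by (simp only: prime_int_mem_iff) simp
      hence "coprime (int p) k" using p by (simp add: prime_imp_coprime)
      hence "coprime k (int p)" by (simp only: coprime_commute)
      then obtain u v where uv: "u * k + v * int p = 1" using bezout_int[of k "int p"] by auto
      have "u * k - 1 = int p * (- v)" using uv by (simp add: algebra_simps)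
      hence "of_int (u * k - 1) \<in> P" unfolding prime_int_mem_iff by simp
      hence "of_int u * of_int k - 1 \<in> P" by simp
      hence "cs (of_int u * of_int k) = cs 1" by (simp only: Od_coset_eq_iff[OF P.is_ideal])
      hence 1: "cs (of_int u) \<otimes>\<^bsub>QR\<^esub> y = \<one>\<^bsub>QR\<^esub>" by (simp add: k cs_mult Od_of_int cs_one)
      moreover have "y \<otimes>\<^bsub>QR\<^esub> cs (of_int u) = \<one>\<^bsub>QR\<^esub>"
        using 1 QR.m_comm[OF cs_closed cs_closed, of "of_int u" "of_int k"] Od_of_int by (simp add: k)
      ultimately show "y \<in> Units (QR\<lparr>carrier := PF\<rparr>)" using y unfolding Units_def by auto
    qed
  qed
qed

text \<open>The cosets of 1 and \<open>\<omega>\<close> form a basis over the prime field. The exact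
  value lets the condition \<open>residue_degree d P = 1\<close> exclude inert primes.\<close>

lemma inert_residue_degree:
  assumes inert: "P = scale (of_nat p) Od"
  shows "residue_degree d P = 2"
proof -
  have p0: "p > 0" and p1: "p > 1" using p prime_gt_0_nat prime_gt_1_nat by auto
  have notin: "cs \<omega> \<notin> PF"
  proof
    assume "cs \<omega> \<in> PF"
    then obtain k where "cs \<omega> = cs (of_int k)" by blast
    hence "\<omega> - of_int k \<in> scale (of_nat p) Od" using Od_coset_eq_iff[OF P.is_ideal] inert by metis
    then obtain y where "y \<in> Od" "\<omega> - of_int k = of_nat p * y" by (auto simp: scale_def)
    then obtain a b where "\<omega> - of_int k = of_nat p * (of_int a + of_int b * \<omega>)" by (metis Od_E)
    hence "of_int (- k) + of_int 1 * \<omega> = of_int (int p * a) + of_int (int p * b) * \<omega>"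
      by (simp add: algebra_simps)
    hence "int p * b = 1" unfolding w_coords_int_eq_iff by simp
    hence "int p dvd 1" by (metis dvd_triv_left)
    thus False using p1 by simp
  qed
  have "QR.dimension (Suc 1) PF (QR.line_extension PF (cs \<omega>) PF)"
    by (rule QR.Suc_dim[OF cs_closed[OF Od_w] notin QR.dimension_one[OF prime_field_subfield]])
  moreover have "QR.line_extension PF (cs \<omega>) PF = carrier QR"
  proof (intro equalityI subsetI)
    fix z assume "z \<in> QR.line_extension PF (cs \<omega>) PF"
    then obtain k m where "z = cs (of_int k) \<otimes>\<^bsub>QR\<^esub> cs \<omega> \<oplus>\<^bsub>QR\<^esub> cs (of_int m)"
      by (auto simp: QR.line_extension_mem_iff)
    thus "z \<in> carrier QR" using cs_closed Od_of_int Od_w by simp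
  next
    fix z assume "z \<in> carrier QR"
    then obtain x where "x \<in> Od" "z = cs x" by (auto simp: carrier_Quot)
    then obtain a b where "z = cs (of_int a + of_int b * \<omega>)" by (metis Od_E)
    hence "z = cs (of_int b) \<otimes>\<^bsub>QR\<^esub> cs \<omega> \<oplus>\<^bsub>QR\<^esub> cs (of_int a)"
      by (simp add: cs_mult cs_add Od_of_int Od_w Od_mult add.commute)
    thus "z \<in> QR.line_extension PF (cs \<omega>) PF" unfolding QR.line_extension_mem_iff by blast
  qed
  ultimately have dim: "QR.dimension 2 PF (carrier QR)" by (simp add: numeral_2_eq_2)
  show ?thesis
    unfolding residue_degree_def
  proof (rule the_equality)
    show "QR.dimension 2 PF (carrier QR)" by (rule dim)
  qed (rule QR.dimension_is_inj[OF prime_field_subfield _ dim])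
qed

text \<open>Modulo \<open>P\<close>, \<open>\<omega>\<close> is congruent to \<open>- b\<close>, so
  every coset contains an integer, unique modulo \<open>p\<close>.\<close>

lemma split_norm:
  assumes "P = quad_ideal (int p) b" shows "ideal_norm d P = p"
proof -
  have "carrier QR = (\<lambda>k. cs (of_int k)) ` {0..<int p}"
  proof
    show "(\<lambda>k. cs (of_int k)) ` {0..<int p} \<subseteq> carrier QR" using cs_closed Od_of_int by auto
    show "carrier QR \<subseteq> (\<lambda>k. cs (of_int k)) ` {0..<int p}"
    proof
      fix z assume "z \<in> carrier QR"
      then obtain x where "x \<in> Od" "z = cs x" by (auto simp: carrier_Quot)
      then obtain x y where z: "z = cs (of_int x + of_int y * \<omega>)" by (metis Od_E)
      let ?k = "(x - b * y) mod int p"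
      have "int p dvd (x - b * y) - ?k" by (rule dvd_minus_mod)
      also have "(x - b * y) - ?k = (x - ?k) - b * y" by simp
      finally have "int p dvd (x - ?k) - b * y" .
      hence "of_int (x - ?k) + of_int y * \<omega> \<in> P" unfolding assms quad_ideal_iff .
      hence "(of_int x + of_int y * \<omega>) - of_int ?k \<in> P" by (simp add: algebra_simps)
      hence "z = cs (of_int ?k)" unfolding z by (simp only: Od_coset_eq_iff[OF P.is_ideal])
      thus "z \<in> (\<lambda>k. cs (of_int k)) ` {0..<int p}"
        using prime_gt_0_nat[OF p] by (intro image_eqI[of _ _ ?k]) simp_all
    qed
  qed
  moreover have "inj_on (\<lambda>k. cs (of_int k)) {0..<int p}"
  proof (rule inj_onI)
    fix k m assume km: "k \<in> {0..<int p}" "m \<in> {0..<int p}" "cs (of_int k) = cs (of_int m)"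
    hence "of_int (k - m) \<in> P" using Od_coset_eq_iff[OF P.is_ideal] by simp
    hence "int p dvd k - m" by (simp only: prime_int_mem_iff)
    hence "k mod int p = m mod int p" by (simp add: mod_eq_dvd_iff)
    thus "k = m" using km by simp
  qed
  ultimately show ?thesis unfolding ideal_norm_def by (simp add: card_image)
qed

end

end

subsection \<open>Primes of degree one\<close>

context imag_quad
begin

section \<open>Ramification at a double root\<close>

lemma ideal_prod_Od: "ideal_prod (quad_integers d) I J = fprod I J"
proof
  show "ideal_prod (quad_integers d) I J \<subseteq> fprod I J"
  proof
    fix x assume "x \<in> ideal_prod (quad_integers d) I J"
    thus "x \<in> fprod I J" by (induction rule: ideal_prod.induct) (simp_all add: fprodI fprod_add)
  qed
  show "fprod I J \<subseteq> ideal_prod (quad_integers d) I J"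
    using ideal_prod.prod[of _ I _ J "quad_integers d"] ideal_prod.sum[of _ "quad_integers d" I J]
    by (intro fprod_least) simp_all
qed

lemma ideals_set_pow:
  "P [^]\<^bsub>ideals_set (quad_integers d)\<^esub> (0::nat) = Od"
  "P [^]\<^bsub>ideals_set (quad_integers d)\<^esub> Suc e = fprod (P [^]\<^bsub>ideals_set (quad_integers d)\<^esub> e) P"
  by (simp_all add: nat_pow_def ideals_set_def ideal_prod_Od)

lemma quad_ideal_eq_if_dvd: "a dvd b - b' \<Longrightarrow> quad_ideal a b = quad_ideal a b'"
proof -
  assume *: "a dvd b - b'"
  have "a dvd x - b * y \<longleftrightarrow> a dvd x - b' * y" for x y
  proof -
    have "x - b' * y = (x - b * y) + (b - b') * y" by (simp add: algebra_simps)
    moreover have "a dvd (b - b') * y" using * by simp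
    ultimately show ?thesis by (metis dvd_add_left_iff)
  qed
  thus ?thesis unfolding quad_ideal_def by simp
qed

text \<open>At a double root \<open>b\<close> is congruent to its conjugate root modulo
  \<open>p\<close>, so \<open>P\<close> is its own conjugate and its square is generated by
  \<open>p\<close>.\<close>

lemma double_root_ramified:
  assumes P: "primeideal P (quad_integers d)" and p: "Factorial_Ring.prime p" and pP: "of_nat p \<in> P"
    and PI: "P = quad_ideal (int p) b" and dvd: "int p dvd wnorm b" and dbl: "int p dvd 2 * b + tr_w"
  shows "ramification_index d P \<ge> 2"
proof -
  interpret P: primeideal P "quad_integers d" by (rule P)
  note primeD = ideal_OdD[OF P.is_ideal]
  let ?fpow = "\<lambda>e::nat. P [^]\<^bsub>ideals_set (quad_integers d)\<^esub> e"
  have p0: "p > 0" using p prime_gt_0_nat by blast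
  have "P = quad_ideal (int p) (- b - tr_w)" unfolding PI using dbl by (intro quad_ideal_eq_if_dvd) (simp add: algebra_simps)
  hence PP: "fprod P P = scale (of_nat p) Od"
    using quad_ideal_mult_conj[of "int p" b] p0 dvd PI by simp
  have fprod_left_Od: "fprod Od J = J" if "ideal J (quad_integers d)" for J
    using fprod_Od ideal_OdD(2-4)[OF that] by metis
  have fpow2: "?fpow 2 = scale (of_nat p) Od"
    by (simp only: numeral_2_eq_2 ideals_set_pow fprod_left_Od[OF P.is_ideal] PP)
  have "?fpow (Suc 2) = scale (of_nat p) P"
    by (simp only: ideals_set_pow(2) fpow2 fprod_scale fprod_left_Od[OF P.is_ideal])
  moreover have "(3::nat) = Suc 2" by simp
  ultimately have fpow3: "?fpow 3 = scale (of_nat p) P" by (simp only:)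
  have right_Od: "fprod J A \<subseteq> J" if "\<And>x y. x \<in> J \<Longrightarrow> y \<in> J \<Longrightarrow> x + y \<in> J" "\<And>a x. a \<in> Od \<Longrightarrow> x \<in> J \<Longrightarrow> a * x \<in> J" "A \<subseteq> Od" for J A
  proof (rule fprod_least)
    fix i j assume "i \<in> J" "j \<in> A"
    thus "i * j \<in> J" using that(2)[of j i] that(3) by (auto simp: mult.commute)
  qed (rule that(1))
  have pPadd: "x + y \<in> scale (of_nat p) P" if "x \<in> scale (of_nat p) P" "y \<in> scale (of_nat p) P" for x y
    using that p0 primeD(3) by (simp add: scale_mem add_divide_distrib)
  have pPmult: "a * x \<in> scale (of_nat p) P" if "a \<in> Od" "x \<in> scale (of_nat p) P" for a x
    using that p0 primeD(4)[of a "x / of_nat p"] by (simp add: scale_mem)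
  have fpow: "?fpow e \<subseteq> scale (of_nat p) P" if "e \<ge> 3" for e
    using that
  proof (induction e rule: dec_induct)
    case base thus ?case using fpow3 by simp
  next
    case (step e)
    have "fprod (?fpow e) P \<subseteq> fprod (scale (of_nat p) P) P" using step.IH by (intro fprod_mono) auto
    also have "\<dots> \<subseteq> scale (of_nat p) P" by (rule right_Od[OF pPadd pPmult primeD(1)])
    finally show ?case by (simp only: ideals_set_pow)
  qed
  have PIdl: "PIdl\<^bsub>quad_integers d\<^esub> (of_nat p) = scale (of_nat p) Od"
    by (auto simp: cgenideal_def scale_def mult.commute)
  have below: "prime_below P = p" by (rule prime_below_eq[OF P p pP])
  let ?R = "\<lambda>e. \<exists>J. ideal J (quad_integers d) \<and>
        PIdl\<^bsub>quad_integers d\<^esub> (of_nat (prime_below P)) = ?fpow e \<cdot>\<^bsub>quad_integers d\<^esub> J"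
  have "?R 2"
  proof (intro exI conjI)
    show "ideal Od (quad_integers d)" by (rule Od.oneideal)
    show "PIdl\<^bsub>quad_integers d\<^esub> (of_nat (prime_below P)) = ?fpow 2 \<cdot>\<^bsub>quad_integers d\<^esub> Od"
      unfolding below PIdl ideal_prod_Od fpow2 fprod_scale fprod_left_Od[OF Od.oneideal] ..
  qed
  \<comment> \<open>\<open>GREATEST\<close> is informative only for a bounded set of exponents. From
    the third power on, everything lies in \<open>p P\<close>, so a factorisation of the ideal of
    \<open>p\<close> would put 1 into \<open>P\<close>.\<close>
  moreover have "e \<le> 2" if Re: "?R e" for e
  proof (rule ccontr)
    assume "\<not> e \<le> 2"
    hence e: "e \<ge> 3" by simp
    obtain J where J: "ideal J (quad_integers d)" "scale (of_nat p) Od = fprod (?fpow e) J"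
      using Re unfolding below PIdl ideal_prod_Od by blast
    have "scale (of_nat p) Od \<subseteq> fprod (scale (of_nat p) P) J" unfolding J(2) using fpow[OF e] by (intro fprod_mono) auto
    also have "\<dots> \<subseteq> scale (of_nat p) P" by (rule right_Od[OF pPadd pPmult ideal_OdD(1)[OF J(1)]])
    finally have "of_nat p * 1 \<in> scale (of_nat p) P" using scaleI[OF Od_1] by blast
    hence "1 \<in> P" using p0 by (simp add: scale_mem)
    thus False using one_notin_prime[OF P p pP] by blast
  qed
  ultimately show ?thesis
    unfolding ramification_index_def by (intro Greatest_le_nat[where b = 2]) auto
qed

text \<open>A split prime through explicit data: \<open>b\<close> is a simple root of
  \<open>wnorm\<close> modulo \<open>p\<close>. In this form the notion passes to the conjugate
  ideal without a return to \<open>degree_one_primes\<close>.\<close>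

definition splits :: "nat \<Rightarrow> int \<Rightarrow> complex set \<Rightarrow> bool" where
  "splits p b P \<longleftrightarrow> Factorial_Ring.prime p \<and> int p dvd wnorm b \<and> \<not> int p dvd 2 * b + tr_w \<and> P = quad_ideal (int p) b"

text \<open>Residue degree 1 excludes the inert case, ramification index 1 excludes a double root,
  and the ideal norm is \<open>p\<close>.\<close>

lemma degree_one_prime_splits:
  assumes "P \<in> degree_one_primes d Z"
  obtains p b where "splits p b P" "real p \<le> Z"
proof -
  have P: "primeideal P (quad_integers d)" "P \<noteq> {0}" "ramification_index d P = 1"
    "residue_degree d P = 1" "real (ideal_norm d P) \<le> Z"
    using assms by (auto simp: degree_one_primes_def)
  obtain p where p: "Factorial_Ring.prime p" "of_nat p \<in> P" using prime_in_primeideal[OF P(1,2)] .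
  have "P \<noteq> scale (of_nat p) Od" using inert_residue_degree[OF P(1) p] P(4) by auto
  then obtain b where b: "P = quad_ideal (int p) b" "int p dvd wnorm b" using prime_dichotomy[OF P(1) p] by blast
  have "\<not> int p dvd 2 * b + tr_w" using double_root_ramified[OF P(1) p b] P(3) by auto
  moreover have "real p \<le> Z" using split_norm[OF P(1) p b(1)] P(5) by simp
  ultimately show thesis using that b p unfolding splits_def by blast
qed

lemma splits_frac: "splits p b P \<Longrightarrow> fractional_ideal d P"
  unfolding splits_def using quad_ideal_frac[of "int p" b] prime_gt_0_nat[of p] by auto

lemma splits_sub: "splits p b P \<Longrightarrow> P \<subseteq> Od" unfolding splits_def using quad_ideal_sub by simp

lemma splits_cnj: "splits p b P \<Longrightarrow> splits p (- b - tr_w) (cnj ` P)"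
proof -
  assume s: "splits p b P"
  have "2 * (- b - tr_w) + tr_w = - (2 * b + tr_w)" by simp
  hence "\<not> int p dvd 2 * (- b - tr_w) + tr_w" using s unfolding splits_def by (simp only: dvd_minus_iff) simp
  thus ?thesis using s unfolding splits_def by (simp only: cnj_quad_ideal wnorm_conj) simp
qed

lemma splits_mult_cnj: "splits p b P \<Longrightarrow> fprod P (cnj ` P) = scale (of_nat p) Od"
  unfolding splits_def using quad_ideal_mult_conj[of "int p" b] prime_gt_0_nat[of p] by (auto simp: cnj_quad_ideal)

text \<open>\<open>P\<close> is the kernel of the ring homomorphism to the integers modulo
  \<open>p\<close> that sends \<open>\<omega>\<close> to \<open>- b\<close>, and the target is a
  field.\<close>

lemma splits_prime:
  assumes "splits p b P" "x \<in> Od" "y \<in> Od" "x * y \<in> P" shows "x \<in> P \<or> y \<in> P"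
proof -
  have p: "Factorial_Ring.prime (int p)" "int p dvd wnorm b" "P = quad_ideal (int p) b"
    using assms(1) unfolding splits_def by auto
  obtain u v where x: "x = of_int u + of_int v * \<omega>" using assms(2) by (elim Od_E)
  obtain u' v' where y: "y = of_int u' + of_int v' * \<omega>" using assms(3) by (elim Od_E)
  have "(u - b * v) * (u' - b * v')
      = ((u * u' - v * v' * nm_w) - b * (u * v' + v * u' + v * v' * tr_w)) + v * v' * wnorm b"
    by (simp add: wnorm_def power2_eq_square algebra_simps)
  moreover have "int p dvd (u * u' - v * v' * nm_w) - b * (u * v' + v * u' + v * v' * tr_w)"
    using assms(4) unfolding p(3) x y w_lin_mult quad_ideal_iff .
  ultimately have "int p dvd (u - b * v) * (u' - b * v')" using p(2) by simp
  hence "int p dvd u - b * v \<or> int p dvd u' - b * v'" using p(1) prime_dvd_mult_iff by blast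
  thus ?thesis unfolding p(3) x y quad_ideal_iff .
qed

text \<open>\<open>p\<close> lies in \<open>Q\<close>, which forces \<open>q = p\<close>; then
  \<open>b + \<omega>\<close> lies in \<open>Q\<close>, which forces \<open>b\<close> and
  \<open>c\<close> to agree modulo \<open>p\<close>.\<close>

lemma splits_subset_imp_eq:
  assumes P: "splits p b P" and Q: "splits q c Q" and sub: "P \<subseteq> Q" shows "P = Q"
proof -
  have P': "Factorial_Ring.prime p" "P = quad_ideal (int p) b" and Q': "Factorial_Ring.prime q" "Q = quad_ideal (int q) c"
    using P Q unfolding splits_def by auto
  have "of_int (int p) + of_int 0 * \<omega> \<in> Q" using sub quad_ideal_a[of "int p" b] P'(2) by auto
  hence "int q dvd int p" unfolding Q'(2) quad_ideal_iff by simp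
  hence pq: "q = p" using P'(1) Q'(1) primes_dvd_imp_eq by (metis of_nat_dvd_iff)
  have "of_int b + of_int 1 * \<omega> \<in> Q" using sub quad_ideal_bw[of b "int p"] P'(2) by auto
  hence "int p dvd b - c" unfolding Q'(2) quad_ideal_iff pq by simp
  thus ?thesis unfolding P'(2) Q'(2) pq by (rule quad_ideal_eq_if_dvd)
qed

text \<open>The containment would identify \<open>b\<close> with its conjugate root modulo
  \<open>p\<close>, making it a double root.\<close>

lemma splits_not_cnj_subset: "splits p b P \<Longrightarrow> \<not> cnj ` P \<subseteq> P"
proof
  assume s: "splits p b P" and "cnj ` P \<subseteq> P"
  hence "quad_ideal (int p) (- b - tr_w) \<subseteq> quad_ideal (int p) b" unfolding splits_def cnj_quad_ideal[symmetric] by simp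
  hence "of_int (- b - tr_w) + of_int 1 * \<omega> \<in> quad_ideal (int p) b" using quad_ideal_bw[of "- b - tr_w" "int p"] by auto
  hence "int p dvd - (2 * b + tr_w)" unfolding quad_ideal_iff by (simp add: algebra_simps)
  thus False using s unfolding splits_def by (simp only: dvd_minus_iff)
qed

lemma one_notin_splits: "splits p b P \<Longrightarrow> 1 \<notin> P"
proof
  assume s: "splits p b P" and "1 \<in> P"
  hence "of_int 1 + of_int 0 * \<omega> \<in> quad_ideal (int p) b" unfolding splits_def by simp
  hence "int p dvd 1" unfolding quad_ideal_iff by simp
  thus False using s prime_gt_1_nat[of p] unfolding splits_def by simp
qed

section \<open>Powers and conjugates of ideals\<close>

abbreviation fpow :: "complex set \<Rightarrow> nat \<Rightarrow> complex set" where "fpow J n \<equiv> J [^]\<^bsub>IG\<^esub> n"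

lemma fpow_frac: "fractional_ideal d J \<Longrightarrow> fractional_ideal d (fpow J n)"
  using IG.nat_pow_closed[of J n] by simp

lemma fpow_mem: "x \<in> J \<Longrightarrow> x ^ n \<in> fpow J n"
proof (induction n)
  case (Suc n) thus ?case using fprodI[of "x ^ n" "fpow J n" x J] by (simp add: mult.commute)
qed (simp add: Od_1)

lemma fprod_integral: "I \<subseteq> Od \<Longrightarrow> J \<subseteq> Od \<Longrightarrow> fprod I J \<subseteq> Od"
  by (rule fprod_least) (auto intro: Od_mult Od_add)

lemma fprod_sub_right:
  assumes "fractional_ideal d J" "I \<subseteq> Od" shows "fprod I J \<subseteq> J"
  by (rule fprod_least) (use assms fracD(3,4)[OF assms(1)] in auto)

lemma fprod_sub_left:
  assumes "fractional_ideal d J" "I \<subseteq> Od" shows "fprod J I \<subseteq> J"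
  using fprod_sub_right[OF assms] by (simp only: fprod_comm)

lemma fpow_integral: "J \<subseteq> Od \<Longrightarrow> fpow J n \<subseteq> Od"
  by (induction n) (auto simp: fprod_integral)

lemma fpow_sub:
  assumes "fractional_ideal d J" "J \<subseteq> Od" "n > 0" shows "fpow J n \<subseteq> J"
proof -
  obtain m where "n = Suc m" using assms(3) gr0_implies_Suc by blast
  thus ?thesis using fprod_sub_right[OF assms(1) fpow_integral[OF assms(2)]] by simp
qed

lemma splits_power:
  assumes "splits p b P" "x \<in> Od" "x ^ n \<in> P" shows "x \<in> P"
  using assms(3)
proof (induction n)
  case (Suc n)
  hence "x * x ^ n \<in> P" by simp
  thus ?case using splits_prime[OF assms(1,2) Od_power[OF assms(2)]] Suc.IH by blast
qed (use one_notin_splits[OF assms(1)] in simp)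

text \<open>The substitute for unique factorisation, argued on elements: for \<open>x\<close> in
  \<open>A\<close> and \<open>y\<close> in \<open>B\<close>, both outside \<open>P\<close>, the
  power \<open>(x * y) ^ n\<close> would lie in \<open>P\<close>.\<close>

lemma fpow_prod_sub_splits:
  assumes P: "splits p b P" and "A \<subseteq> Od" "B \<subseteq> Od" "fpow (fprod A B) n \<subseteq> P"
  shows "A \<subseteq> P \<or> B \<subseteq> P"
proof (rule ccontr)
  assume "\<not> ?thesis"
  then obtain x y where xy: "x \<in> A" "x \<notin> P" "y \<in> B" "y \<notin> P" by blast
  have O: "x \<in> Od" "y \<in> Od" using xy assms by auto
  have "(x * y) ^ n \<in> P" using fpow_mem[OF fprodI[OF xy(1,3)]] assms(4) by blast
  hence "x * y \<in> P" using splits_power[OF P Od_mult[OF O]] by blast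
  thus False using splits_prime[OF P O] xy by blast
qed

text \<open>For \<open>x\<close> in \<open>P\<close>, \<open>x ^ n\<close> lies in the common power
  and so in \<open>Q\<close>; primality gives \<open>P \<subseteq> Q\<close>, and such inclusions
  are equalities.\<close>

lemma splits_fpow_inj:
  assumes P: "splits p b P" and Q: "splits q c Q" and "fpow P n = fpow Q n" "n > 0" shows "P = Q"
proof (rule splits_subset_imp_eq[OF P Q], rule subsetI)
  fix x assume x: "x \<in> P"
  have "x ^ n \<in> fpow Q n" using fpow_mem[OF x] assms(3) by metis
  hence "x ^ n \<in> Q" using fpow_sub[OF splits_frac[OF Q] splits_sub[OF Q] assms(4)] by blast
  thus "x \<in> Q" using splits_power[OF Q] splits_sub[OF P] x by blast
qed

lemma cnj_cnj_image [simp]: "cnj ` cnj ` J = J" by (simp add: image_image)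

lemma cnj_fprod: "cnj ` fprod I J = fprod (cnj ` I) (cnj ` J)"
proof -
  have 1: "fprod (cnj ` I) (cnj ` J) \<subseteq> cnj ` fprod I J" for I J
  proof (rule fprod_least)
    fix i j assume "i \<in> cnj ` I" "j \<in> cnj ` J"
    then obtain i' j' where "i' \<in> I" "i = cnj i'" "j' \<in> J" "j = cnj j'" by blast
    thus "i * j \<in> cnj ` fprod I J" using imageI[OF fprodI[of i' I j' J], of cnj] by simp
  next
    fix x y assume "x \<in> cnj ` fprod I J" "y \<in> cnj ` fprod I J"
    then obtain x' y' where "x' \<in> fprod I J" "x = cnj x'" "y' \<in> fprod I J" "y = cnj y'" by blast
    thus "x + y \<in> cnj ` fprod I J" using imageI[OF fprod_add[of x' I J y'], of cnj] by simp
  qed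
  have "cnj ` fprod (cnj ` cnj ` I) (cnj ` cnj ` J) \<subseteq> cnj ` cnj ` fprod (cnj ` I) (cnj ` J)"
    by (rule image_mono[OF 1])
  thus ?thesis using 1[of I J] by simp
qed

lemma cnj_Od: "cnj ` Od = Od"
proof -
  have 1: "cnj ` Od \<subseteq> Od" using Od_cnj by blast
  have "cnj ` cnj ` Od \<subseteq> cnj ` Od" by (rule image_mono[OF 1])
  thus ?thesis using 1 by simp
qed

lemma cnj_fpow: "cnj ` fpow J n = fpow (cnj ` J) n"
  by (induction n) (simp_all add: cnj_Od cnj_fprod)

lemma cnj_scale: "cnj ` scale c J = scale (cnj c) (cnj ` J)" by (simp add: scale_def image_image)

lemma fpow_scale_Od: "fpow (scale c Od) n = scale (c ^ n) Od"
  by (induction n) (simp_all add: scale_Od_mult mult.commute)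

text \<open>Both quotients of \<open>r\<close> and \<open>s\<close> are rational algebraic integers,
  that is, mutually inverse positive integers. It turns an equality of norm ideals into the equation
  required by \<open>S_set\<close>.\<close>

lemma scale_Od_eq_pos_rat:
  assumes "r > 0" "s > 0" "scale (of_rat r) Od = scale (of_rat s) Od" shows "r = s"
proof -
  have int: "x / y \<in> \<int>" if "y > 0" "scale (of_rat x) Od = scale (of_rat y) Od" for x y :: rat
  proof -
    have "of_rat x * 1 \<in> scale (of_rat x) Od" by (rule scaleI[OF Od_1])
    hence "of_rat x / of_rat y \<in> Od" using that by (simp add: scale_mem)
    thus ?thesis using Od_rat_int[of "x / y"] by (simp add: of_rat_divide)
  qed
  obtain m where m: "r / s = of_int m" using int[OF assms(2,3)] by (auto elim: Ints_cases)
  obtain n where n: "s / r = of_int n" using int[OF assms(1) assms(3)[symmetric]] by (auto elim: Ints_cases)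
  have "of_int m * of_int n = (1 :: rat)" using assms(1,2) by (simp flip: m n)
  hence "(of_int (m * n) :: rat) = of_int 1" by simp
  hence "m * n = 1" by (simp only: of_int_eq_iff)
  moreover have "m > 0"
  proof -
    have "r / s > 0" using assms by simp
    thus ?thesis unfolding m by simp
  qed
  ultimately have "m = 1" by (simp add: zmult_eq_1_iff)
  thus ?thesis using m assms(2) by (simp add: field_simps)
qed

end

subsection \<open>Counting pairs\<close>

text \<open>Cauchy--Schwarz against the constant 1, from expanding the nonnegative double sum of
  squared differences.\<close>

lemma sum_squared_le_card_sum_squares:
  fixes n :: "'a \<Rightarrow> real"
  shows "(\<Sum>b\<in>B. n b)\<^sup>2 \<le> real (card B) * (\<Sum>b\<in>B. (n b)\<^sup>2)"
proof -
  have "0 \<le> (\<Sum>b\<in>B. \<Sum>c\<in>B. (n b - n c)\<^sup>2)" by (intro sum_nonneg) simp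
  also have "\<dots> = (\<Sum>b\<in>B. \<Sum>c\<in>B. (n b)\<^sup>2) + (\<Sum>b\<in>B. \<Sum>c\<in>B. (n c)\<^sup>2) - 2 * (\<Sum>b\<in>B. \<Sum>c\<in>B. n b * n c)"
    by (simp add: power2_diff sum.distrib sum_subtractf sum_distrib_left mult.assoc)
  also have "(\<Sum>b\<in>B. \<Sum>c\<in>B. n b * n c) = (\<Sum>b\<in>B. n b)\<^sup>2" by (simp add: power2_eq_square sum_product)
  finally show ?thesis by (simp flip: sum_distrib_left)
qed

lemma card_squared_le_card_image_mult_pairs:
  assumes "finite A"
  shows "(real (card A))\<^sup>2 \<le> real (card (f ` A)) * real (card {(x, y). x \<in> A \<and> y \<in> A \<and> f x = f y})"
proof -
  let ?F = "\<lambda>b. {x \<in> A. f x = b}" and ?E = "{(x, y). x \<in> A \<and> y \<in> A \<and> f x = f y}"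
  have finE: "finite ?E" by (rule finite_subset[of _ "A \<times> A"]) (use assms in auto)
  have "card A = (\<Sum>b\<in>f ` A. card (?F b))"
    using sum.image_gen[OF assms, of "\<lambda>_. 1::nat" f] by simp
  hence A: "real (card A) = (\<Sum>b\<in>f ` A. real (card (?F b)))" by simp
  have im: "(\<lambda>e. f (fst e)) ` ?E = f ` A" by force
  have "card ?E = (\<Sum>b\<in>f ` A. card {e \<in> ?E. f (fst e) = b})"
    using sum.image_gen[OF finE, of "\<lambda>_. 1::nat" "\<lambda>e. f (fst e)"] im by simp
  also have "\<dots> = (\<Sum>b\<in>f ` A. (card (?F b))\<^sup>2)"
  proof (rule sum.cong[OF refl])
    fix b
    have "{e \<in> ?E. f (fst e) = b} = ?F b \<times> ?F b" by auto
    thus "card {e \<in> ?E. f (fst e) = b} = (card (?F b))\<^sup>2" by (simp add: card_cartesian_product power2_eq_square)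
  qed
  finally have E: "real (card ?E) = (\<Sum>b\<in>f ` A. (real (card (?F b)))\<^sup>2)" by simp
  show ?thesis unfolding A E by (rule sum_squared_le_card_sum_squares)
qed

lemma card_le_twice_if_fibres:
  assumes "finite E" "finite S" "g ` E \<subseteq> S" "\<And>e. e \<in> E \<Longrightarrow> card {e' \<in> E. g e' = g e} \<le> 2"
  shows "card E \<le> 2 * card S"
proof -
  have "card E = (\<Sum>s\<in>g ` E. card {e \<in> E. g e = s})"
    using sum.image_gen[OF assms(1), of "\<lambda>_. 1::nat" g] by simp
  also have "\<dots> \<le> (\<Sum>s\<in>g ` E. 2)" by (intro sum_mono) (use assms(4) in auto)
  also have "\<dots> \<le> 2 * card S" using card_mono[OF assms(2,3)] by simp
  finally show ?thesis .
qed

context comm_group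
begin

text \<open>Choose an \<open>l\<close>-th root \<open>s b\<close> of each power \<open>b\<close>.
  From \<open>t \<otimes> s b\<close> with \<open>t\<close> torsion, the \<open>l\<close>-th power
  recovers \<open>b\<close>, and cancelling \<open>s b\<close> recovers \<open>t\<close>.\<close>

lemma card_torsion_mult_card_powers_le:
  fixes l :: nat
  assumes fin: "finite (carrier G)"
  shows "card {c \<in> carrier G. c [^] l = \<one>} * card ((\<lambda>c. c [^] l) ` carrier G) \<le> card (carrier G)"
proof -
  let ?T = "{c \<in> carrier G. c [^] l = \<one>}" and ?I = "(\<lambda>c. c [^] l) ` carrier G"
  define s where "s b = (SOME x. x \<in> carrier G \<and> x [^] l = b)" for b
  have s: "s b \<in> carrier G" "s b [^] l = b" if "b \<in> ?I" for b
  proof -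
    have "\<exists>x. x \<in> carrier G \<and> x [^] l = b" using that by blast
    from someI_ex[OF this] show "s b \<in> carrier G" "s b [^] l = b" unfolding s_def by auto
  qed
  have "inj_on (\<lambda>(t, b). t \<otimes> s b) (?T \<times> ?I)"
  proof (rule inj_onI, clarify)
    fix t x t' x'
    assume t: "t \<in> carrier G" "t [^] l = \<one>" and t': "t' \<in> carrier G" "t' [^] l = \<one>"
      and x: "x \<in> carrier G" and x': "x' \<in> carrier G"
      and eq: "t \<otimes> s (x [^] l) = t' \<otimes> s (x' [^] l)"
    note s1 = s[of "x [^] l", OF imageI[OF x]] and s2 = s[of "x' [^] l", OF imageI[OF x']]
    have "(t \<otimes> s (x [^] l)) [^] l = x [^] l" using t x s1 by (simp add: nat_pow_distrib)
    moreover have "(t' \<otimes> s (x' [^] l)) [^] l = x' [^] l" using t' x' s2 by (simp add: nat_pow_distrib)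
    ultimately have "x [^] l = x' [^] l" using eq by simp
    thus "t = t' \<and> x [^] l = x' [^] l" using eq t t' s1 s2 by simp
  qed
  moreover have "(\<lambda>(t, b). t \<otimes> s b) ` (?T \<times> ?I) \<subseteq> carrier G" using s by auto
  ultimately have "card (?T \<times> ?I) \<le> card (carrier G)" using fin by (rule card_inj_on_le)
  thus ?thesis by (simp add: card_cartesian_product)
qed

end

context imag_quad
begin

section \<open>Finiteness of the set of generators\<close>

lemma finite_bounded_Od: "finite {z \<in> Od. cmod z \<le> B}"
proof -
  define Y where "Y = \<lceil>B / Im \<omega>\<rceil>"
  define X where "X = \<lceil>B + of_int Y * \<bar>Re \<omega>\<bar>\<rceil>"
  have "{z \<in> Od. cmod z \<le> B} \<subseteq> (\<lambda>(x, y). of_int x + of_int y * \<omega>) ` ({- X..X} \<times> {- Y..Y})"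
  proof
    fix z assume "z \<in> {z \<in> Od. cmod z \<le> B}"
    hence z: "z \<in> Od" "cmod z \<le> B" by auto
    obtain x y where xy: "z = of_int x + of_int y * \<omega>" using z(1) by (elim Od_E)
    have "\<bar>Im z\<bar> \<le> B" using z(2) abs_Im_le_cmod order_trans by blast
    hence "\<bar>of_int y\<bar> * Im \<omega> \<le> B" using Im_w(1) by (simp add: xy abs_mult)
    hence "\<bar>real_of_int y\<bar> \<le> B / Im \<omega>" using Im_w(1) by (simp add: field_simps)
    also have "\<dots> \<le> of_int Y" unfolding Y_def by (rule le_of_int_ceiling)
    finally have Y: "\<bar>real_of_int y\<bar> \<le> of_int Y" .
    have "\<bar>Re z\<bar> \<le> B" using z(2) abs_Re_le_cmod order_trans by blast
    moreover have "real_of_int x = Re z - of_int y * Re \<omega>" by (simp add: xy)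
    moreover have "\<bar>of_int y * Re \<omega>\<bar> \<le> of_int Y * \<bar>Re \<omega>\<bar>"
      unfolding abs_mult using Y by (intro mult_right_mono) auto
    ultimately have "\<bar>real_of_int x\<bar> \<le> B + of_int Y * \<bar>Re \<omega>\<bar>" by linarith
    also have "\<dots> \<le> of_int X" unfolding X_def by (rule le_of_int_ceiling)
    finally have "\<bar>real_of_int x\<bar> \<le> of_int X" .
    hence "(x, y) \<in> {- X..X} \<times> {- Y..Y}" using Y by auto
    thus "z \<in> (\<lambda>(x, y). of_int x + of_int y * \<omega>) ` ({- X..X} \<times> {- Y..Y})"
      by (intro image_eqI[of _ _ "(x, y)"]) (simp_all add: xy)
  qed
  thus ?thesis by (rule finite_subset) simp
qed

lemma norm_rt: "(of_rat u + of_rat v * rt) * cnj (of_rat u + of_rat v * rt) = of_rat (u\<^sup>2 - of_int d * v\<^sup>2)"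
proof -
  have "(of_rat u + of_rat v * rt) * cnj (of_rat u + of_rat v * rt)
      = of_rat u * of_rat u - of_rat v * of_rat v * (rt * rt)" by (simp add: algebra_simps)
  also have "\<dots> = of_rat (u\<^sup>2 - of_int d * v\<^sup>2)"
    by (simp add: rt_sq of_rat_diff of_rat_mult power2_eq_square mult_ac)
  finally show ?thesis .
qed

text \<open>Needed because \<open>card\<close> of an infinite set is 0, which would spoil a bound by
  \<open>card (S_set l d Z)\<close>. The primes are bounded by \<open>Z\<close>, so the norm, and
  with it the absolute value, is bounded.\<close>

lemma finite_S_set: "finite (S_set l d Z)"
proof -
  define B where "B = sqrt ((max Z 0 * max Z 0) ^ l)"
  have "S_set l d Z \<subseteq> {z \<in> Od. cmod z \<le> B}"
  proof
    fix z assume "z \<in> S_set l d Z"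
    then obtain u v p1 p2 where z: "z = of_rat u + of_rat v * rt" "z \<in> Od" "real p1 \<le> Z" "real p2 \<le> Z"
      "(of_nat p1 * of_nat p2) ^ l = u\<^sup>2 - of_int d * v\<^sup>2"
      unfolding S_set_def rt_def by blast
    have "complex_of_real ((cmod z)\<^sup>2) = z * cnj z" by (rule complex_norm_square)
    also have "\<dots> = of_rat ((of_nat p1 * of_nat p2) ^ l)" by (simp only: z(1) norm_rt z(5))
    also have "\<dots> = complex_of_real ((real p1 * real p2) ^ l)" by (simp add: of_rat_power of_rat_mult)
    finally have "(cmod z)\<^sup>2 = (real p1 * real p2) ^ l" by (simp only: of_real_eq_iff)
    also have "\<dots> \<le> (max Z 0 * max Z 0) ^ l" using z(3,4) by (intro power_mono mult_mono) auto
    finally have "cmod z \<le> B" unfolding B_def by (rule real_le_rsqrt)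
    thus "z \<in> {z \<in> Od. cmod z \<le> B}" using z(2) by blast
  qed
  thus ?thesis using finite_bounded_Od finite_subset by blast
qed

text \<open>In the class group the conjugate of \<open>Q\<close> is inverse to \<open>Q\<close>.
  Equal \<open>l\<close>-th powers therefore make the \<open>l\<close>-th power of \<open>P\<close>
  times the conjugate of \<open>Q\<close> principal.\<close>

lemma equal_powers_generator:
  assumes P: "splits p b P" and Q: "splits q c Q" and PQ: "P \<noteq> Q" and l: "l > 0"
    and Z: "real p \<le> Z" "real q \<le> Z"
    and eq: "cls P [^]\<^bsub>CG\<^esub> l = cls Q [^]\<^bsub>CG\<^esub> l"
  obtains \<alpha> where "\<alpha> \<in> S_set l d Z" "fpow (fprod P (cnj ` Q)) l = scale \<alpha> Od"
proof -
  note P' = splits_cnj[OF P] and Q' = splits_cnj[OF Q]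
  note fr = splits_frac[OF P] splits_frac[OF Q] splits_frac[OF P'] splits_frac[OF Q']
  note sub = splits_sub[OF P] splits_sub[OF Q] splits_sub[OF P'] splits_sub[OF Q']
  have pq: "Factorial_Ring.prime p" "Factorial_Ring.prime q" using P Q unfolding splits_def by auto
  have pq0: "p > 0" "q > 0" using pq prime_gt_0_nat by auto
  let ?J = "fprod P (cnj ` Q)"
  have J: "fractional_ideal d ?J" "?J \<subseteq> Od" using fprod_frac fprod_integral fr sub by auto
  have c: "cls P \<in> carrier CG" "cls Q \<in> carrier CG" "cls (cnj ` Q) \<in> carrier CG"
    using cls.hom_closed fr by auto
  have "cls (fpow ?J l) = cls ?J [^]\<^bsub>CG\<^esub> l" using cls.hom_nat_pow J by simp
  also have "cls ?J = cls P \<otimes>\<^bsub>CG\<^esub> cls (cnj ` Q)" using cls.hom_mult[of P "cnj ` Q"] fr by simp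
  also have "(cls P \<otimes>\<^bsub>CG\<^esub> cls (cnj ` Q)) [^]\<^bsub>CG\<^esub> l = cls P [^]\<^bsub>CG\<^esub> l \<otimes>\<^bsub>CG\<^esub> cls (cnj ` Q) [^]\<^bsub>CG\<^esub> l"
    using CG.nat_pow_distrib c by simp
  also have "\<dots> = (cls Q \<otimes>\<^bsub>CG\<^esub> cls (cnj ` Q)) [^]\<^bsub>CG\<^esub> l" using CG.nat_pow_distrib c by (simp add: eq)
  also have "cls Q \<otimes>\<^bsub>CG\<^esub> cls (cnj ` Q) = cls (scale (of_nat q) Od)"
    using cls.hom_mult[of Q "cnj ` Q"] fr splits_mult_cnj[OF Q] by simp
  also have "\<dots> = cls Od"
    using cls_scale[OF Od_frac, of "of_nat q"] K_of_int[of "int q"] pq0 by simp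
  also have "\<dots> = \<one>\<^bsub>CG\<^esub>" using cls.hom_one by simp
  finally have "cls (fpow ?J l) = \<one>\<^bsub>CG\<^esub>" by simp
  hence "fpow ?J l \<in> PG" using cls_eq_one_iff fpow_frac[OF J(1)] by blast
  then obtain \<alpha> where \<alpha>: "\<alpha> \<in> K" "\<alpha> \<noteq> 0" "fpow ?J l = scale \<alpha> Od" by (elim PG_E)
  have "\<alpha> * 1 \<in> scale \<alpha> Od" by (rule scaleI[OF Od_1])
  hence \<alpha>O: "\<alpha> \<in> Od" using fpow_integral[OF J(2), of l] \<alpha>(3) by auto
  have cnjJ: "cnj ` ?J = fprod (cnj ` P) Q" by (simp add: cnj_fprod)
  have cJ: "fractional_ideal d (fprod (cnj ` P) Q)" using fprod_frac fr by blast
  have c\<alpha>: "fpow (fprod (cnj ` P) Q) l = scale (cnj \<alpha>) Od"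
    using arg_cong[OF \<alpha>(3), of "(`) cnj"] by (simp only: cnj_fpow cnjJ cnj_scale cnj_Od)
  \<comment> \<open>Multiplying the ideal by its conjugate determines the norm of
    \<open>\<alpha>\<close> only up to a unit; positivity of both rational numbers then gives
    equality.\<close>
  have "scale (\<alpha> * cnj \<alpha>) Od = fprod (fpow ?J l) (fpow (fprod (cnj ` P) Q) l)"
    by (simp only: \<alpha>(3) c\<alpha> scale_Od_mult)
  also have "\<dots> = fpow (fprod ?J (fprod (cnj ` P) Q)) l"
    using IG.nat_pow_distrib[of ?J "fprod (cnj ` P) Q" l] J cJ by simp
  also have "fprod ?J (fprod (cnj ` P) Q) = fprod (fprod P (cnj ` P)) (fprod Q (cnj ` Q))"
    by (metis fprod_assoc fprod_comm)
  also have "\<dots> = scale (of_nat p * of_nat q) Od" by (simp only: splits_mult_cnj[OF P] splits_mult_cnj[OF Q] scale_Od_mult)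
  finally have norm: "scale (\<alpha> * cnj \<alpha>) Od = scale ((of_nat p * of_nat q) ^ l) Od" by (simp only: fpow_scale_Od)
  obtain u v where uv: "\<alpha> = of_rat u + of_rat v * rt" using \<alpha>(1) K_iff_rt by blast
  let ?n = "u\<^sup>2 - of_int d * v\<^sup>2" and ?m = "(of_nat p * of_nat q) ^ l :: rat"
  have n: "\<alpha> * cnj \<alpha> = of_rat ?n" unfolding uv by (rule norm_rt)
  have "?n \<noteq> 0"
  proof
    assume "?n = 0"
    hence "\<alpha> * cnj \<alpha> = 0" by (simp only: n of_rat_0)
    thus False using \<alpha>(2) by simp
  qed
  moreover have "0 \<le> u\<^sup>2" "0 \<le> - (of_int d * v\<^sup>2)" using dneg by (auto simp: mult_le_0_iff)
  ultimately have "?n > 0" by linarith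
  moreover have "?m > 0" using pq0 by simp
  moreover have "scale (of_rat ?n) Od = scale (of_rat ?m) Od"
    using norm by (simp add: n of_rat_power of_rat_mult)
  ultimately have nm: "?n = ?m" by (rule scale_Od_eq_pos_rat)
  \<comment> \<open>This settles both coordinates at once: \<open>v = 0\<close> means
    \<open>cnj \<alpha> = \<alpha>\<close>, and \<open>u = 0\<close> means
    \<open>cnj \<alpha> = - \<alpha>\<close>, which generates the same ideal.\<close>
  have ne: "scale (cnj \<alpha>) Od \<noteq> scale \<alpha> Od"
  proof
    assume "scale (cnj \<alpha>) Od = scale \<alpha> Od"
    hence "fpow (fprod (cnj ` P) Q) l = fpow ?J l" by (simp only: c\<alpha> \<alpha>(3))
    also have "\<dots> \<subseteq> ?J" by (rule fpow_sub[OF J l])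
    also have "\<dots> \<subseteq> P" by (rule fprod_sub_left[OF fr(1) sub(4)])
    finally have "cnj ` P \<subseteq> P \<or> Q \<subseteq> P" by (rule fpow_prod_sub_splits[OF P sub(3,2)])
    thus False using splits_not_cnj_subset[OF P] splits_subset_imp_eq[OF Q P] PQ by blast
  qed
  have v0: "v \<noteq> 0"
  proof
    assume "v = 0"
    hence "cnj \<alpha> = \<alpha>" by (simp add: uv)
    thus False using ne by simp
  qed
  have u0: "u \<noteq> 0"
  proof
    assume "u = 0"
    hence "cnj \<alpha> = - \<alpha>" by (simp add: uv)
    hence "scale (cnj \<alpha>) Od = scale \<alpha> (scale (of_int (- 1)) Od)" by (simp add: scale_scale)
    also have "scale (of_int (- 1)) Od = Od"
    proof
      show "scale (of_int (- 1)) Od \<subseteq> Od" using Od_mult[OF Od_of_int] by (auto simp only: scale_def)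
      show "Od \<subseteq> scale (of_int (- 1)) Od"
      proof
        fix x assume "x \<in> Od"
        from scaleI[OF Od_uminus[OF this], of "of_int (- 1)"] show "x \<in> scale (of_int (- 1)) Od" by simp
      qed
    qed
    finally show False using ne by simp
  qed
  have "\<alpha> \<in> S_set l d Z"
    unfolding S_set_def rt_def[symmetric] mem_Collect_eq
  proof (rule exI[of _ u], rule exI[of _ v], intro conjI)
    show "\<exists>p1 p2. Factorial_Ring.prime p1 \<and> Factorial_Ring.prime p2 \<and> real p1 \<le> Z \<and> real p2 \<le> Z \<and>
        (of_nat p1 * of_nat p2) ^ l = ?n"
      using pq Z nm[symmetric] by blast
  qed (use uv \<alpha>O u0 v0 in simp_all)
  thus thesis using that \<alpha>(3) by blast
qed

text \<open>\<open>P\<close> contains the product of \<open>P1\<close> and the conjugate of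
  \<open>Q1\<close>, so it is one of them. Its \<open>l\<close>-th power cancels in the group of
  fractional ideals, and split primes are determined by their \<open>l\<close>-th powers.\<close>

lemma splits_pair_eq:
  assumes P: "splits p b P" and Q: "splits q c Q" and P1: "splits p1 b1 P1" and Q1: "splits q1 c1 Q1"
    and l: "l > 0" and eq: "fpow (fprod P (cnj ` Q)) l = fpow (fprod P1 (cnj ` Q1)) l"
  shows "(P1, Q1) = (P, Q) \<or> (P1, Q1) = (cnj ` Q, cnj ` P)"
proof -
  note Qc = splits_cnj[OF Q] and Q1c = splits_cnj[OF Q1]
  note fr = splits_frac[OF P] splits_frac[OF Qc] splits_frac[OF P1] splits_frac[OF Q1c]
  note sub = splits_sub[OF P] splits_sub[OF Qc] splits_sub[OF P1] splits_sub[OF Q1c]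
  have "fpow (fprod P1 (cnj ` Q1)) l \<subseteq> fprod P (cnj ` Q)"
    using fpow_sub[OF fprod_frac[OF fr(1,2)] fprod_integral[OF sub(1,2)] l] eq by simp
  also have "\<dots> \<subseteq> P" by (rule fprod_sub_left[OF fr(1) sub(2)])
  finally have "P1 \<subseteq> P \<or> cnj ` Q1 \<subseteq> P" by (rule fpow_prod_sub_splits[OF P sub(3,4)])
  hence cases: "P1 = P \<or> cnj ` Q1 = P" 
    using splits_subset_imp_eq[OF P1 P] splits_subset_imp_eq[OF Q1c P] by blast
  have prod: "fprod (fpow P l) (fpow (cnj ` Q) l) = fprod (fpow P1 l) (fpow (cnj ` Q1) l)"
    using eq IG.nat_pow_distrib[of P "cnj ` Q" l] IG.nat_pow_distrib[of P1 "cnj ` Q1" l] fr by simp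
  have cancel: "A = B" if "fprod (fpow P l) A = fprod (fpow P l) B" "fractional_ideal d A" "fractional_ideal d B" for A B
    using IG.Units_l_cancel[of "fpow P l" A B] that fpow_frac[OF fr(1)] by simp
  from cases show ?thesis
  proof
    assume e: "P1 = P"
    have "fpow (cnj ` Q) l = fpow (cnj ` Q1) l"
      using cancel[OF _ fpow_frac[OF fr(2)] fpow_frac[OF fr(4)]] prod unfolding e .
    hence "cnj ` Q = cnj ` Q1" using splits_fpow_inj[OF Qc Q1c _ l] by blast
    from arg_cong[OF this, of "(`) cnj"] have "Q = Q1" by (simp only: cnj_cnj_image)
    thus ?thesis using e by simp
  next
    assume e: "cnj ` Q1 = P"
    have "fprod (fpow P l) (fpow (cnj ` Q) l) = fprod (fpow P l) (fpow P1 l)"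
      unfolding prod e by (rule fprod_comm)
    from cancel[OF this fpow_frac[OF fr(2)] fpow_frac[OF fr(3)]] have "fpow (cnj ` Q) l = fpow P1 l" .
    hence "cnj ` Q = P1" using splits_fpow_inj[OF Qc P1 _ l] by blast
    moreover from arg_cong[OF e, of "(`) cnj"] have "Q1 = cnj ` P" by (simp only: cnj_cnj_image)
    ultimately show ?thesis by simp
  qed
qed

lemma torsion_bound:
  assumes l: "l > 0" and pos: "card (degree_one_primes d Z) > 0"
  shows "real (card (class_group_torsion l d)) * (real (card (degree_one_primes d Z)))\<^sup>2
    \<le> real (card (carrier CG)) * (real (card (degree_one_primes d Z)) + 2 * real (card (S_set l d Z)))"
proof -
  let ?\<pi> = "degree_one_primes d Z" and ?S = "S_set l d Z"
  define f where "f P = cls P [^]\<^bsub>CG\<^esub> l" for P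
  define E where "E = {(P, Q). P \<in> ?\<pi> \<and> Q \<in> ?\<pi> \<and> f P = f Q}"
  define E' where "E' = {(P, Q). P \<in> ?\<pi> \<and> Q \<in> ?\<pi> \<and> f P = f Q \<and> P \<noteq> Q}"
  have fin: "finite ?\<pi>" using pos card_gt_0_iff by blast
  have finE': "finite E'" by (rule finite_subset[of _ "?\<pi> \<times> ?\<pi>"]) (use fin in \<open>auto simp: E'_def\<close>)
  have "\<exists>\<alpha>. \<alpha> \<in> ?S \<and> fpow (fprod P (cnj ` Q)) l = scale \<alpha> Od" if PQ: "(P, Q) \<in> E'" for P Q
  proof -
    have "P \<in> ?\<pi>" "Q \<in> ?\<pi>" using PQ by (auto simp: E'_def)
    then obtain p b q c where "splits p b P" "real p \<le> Z" "splits q c Q" "real q \<le> Z"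
      by (elim degree_one_prime_splits)
    thus ?thesis using equal_powers_generator[of p b P q c Q l Z] l PQ
      by (auto simp: E'_def f_def)
  qed
  hence "\<forall>e\<in>E'. \<exists>\<alpha>. \<alpha> \<in> ?S \<and> fpow (fprod (fst e) (cnj ` snd e)) l = scale \<alpha> Od" by auto
  then obtain g where g: "\<And>e. e \<in> E' \<Longrightarrow> g e \<in> ?S"
    "\<And>e. e \<in> E' \<Longrightarrow> fpow (fprod (fst e) (cnj ` snd e)) l = scale (g e) Od"
    using bchoice[of E' "\<lambda>e \<alpha>. \<alpha> \<in> ?S \<and> fpow (fprod (fst e) (cnj ` snd e)) l = scale \<alpha> Od"] by blast
  have two: "card {x, y} \<le> 2" for x y :: "complex set \<times> complex set" by (simp add: card_insert_if)
  have "card E' \<le> 2 * card ?S"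
  proof (rule card_le_twice_if_fibres[OF finE' finite_S_set])
    show "g ` E' \<subseteq> ?S" using g(1) by blast
    fix e assume e: "e \<in> E'"
    obtain P Q where PQ: "e = (P, Q)" by force
    have "{e' \<in> E'. g e' = g e} \<subseteq> {(P, Q), (cnj ` Q, cnj ` P)}"
    proof
      fix e' assume e': "e' \<in> {e' \<in> E'. g e' = g e}"
      obtain P1 Q1 where PQ1: "e' = (P1, Q1)" by force
      have "P \<in> ?\<pi>" "Q \<in> ?\<pi>" "P1 \<in> ?\<pi>" "Q1 \<in> ?\<pi>" using e e' PQ PQ1 by (auto simp: E'_def)
      then obtain p b q c p1 b1 q1 c1 where s: "splits p b P" "splits q c Q" "splits p1 b1 P1" "splits q1 c1 Q1"
        by (elim degree_one_prime_splits)
      have "fpow (fprod P (cnj ` Q)) l = fpow (fprod P1 (cnj ` Q1)) l" using g(2)[OF e] g(2)[of e'] e' PQ PQ1 by simp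
      thus "e' \<in> {(P, Q), (cnj ` Q, cnj ` P)}" using splits_pair_eq[OF s l] PQ1 by blast
    qed
    \<comment> \<open>A generator determines its ideal, and the ideal determines the pair up to
      exchanging and conjugating its members.\<close>
    hence "card {e' \<in> E'. g e' = g e} \<le> card {(P, Q), (cnj ` Q, cnj ` P)}" by (intro card_mono) auto
    also have "\<dots> \<le> 2" by (rule two)
    finally show "card {e' \<in> E'. g e' = g e} \<le> 2" .
  qed
  \<comment> \<open>The diagonal contributes \<open>card ?\<pi>\<close>; after division by its
    square this becomes the first term of the final bound.\<close>
  moreover have "E \<subseteq> (\<lambda>P. (P, P)) ` ?\<pi> \<union> E'" by (auto simp: E_def E'_def)
  hence "card E \<le> card ((\<lambda>P. (P, P)) ` ?\<pi> \<union> E')" using fin finE' by (intro card_mono) auto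
  hence "card E \<le> card ?\<pi> + card E'"
    using card_Un_le[of "(\<lambda>P. (P, P)) ` ?\<pi>" E'] card_image_le[OF fin, of "\<lambda>P. (P, P)"] by linarith
  ultimately have E: "real (card E) \<le> real (card ?\<pi>) + 2 * real (card ?S)" by linarith
  let ?I = "(\<lambda>c. c [^]\<^bsub>CG\<^esub> l) ` carrier CG"
  have "f ` ?\<pi> \<subseteq> ?I"
  proof
    fix x assume "x \<in> f ` ?\<pi>"
    then obtain P where P: "P \<in> ?\<pi>" "x = cls P [^]\<^bsub>CG\<^esub> l" by (auto simp: f_def)
    have "fractional_ideal d P" using P(1) by (elim degree_one_prime_splits) (rule splits_frac)
    thus "x \<in> ?I" using P(2) cls.hom_closed[of P] by auto
  qed
  hence "card (f ` ?\<pi>) \<le> card ?I" using class_number_bound(1) by (intro card_mono) auto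
  moreover have "(real (card ?\<pi>))\<^sup>2 \<le> real (card (f ` ?\<pi>)) * real (card E)"
    unfolding E_def by (rule card_squared_le_card_image_mult_pairs[OF fin])
  ultimately have "(real (card ?\<pi>))\<^sup>2 \<le> real (card ?I) * real (card E)"
    by (meson mult_right_mono of_nat_0_le_iff of_nat_mono order_trans)
  hence "real (card (class_group_torsion l d)) * (real (card ?\<pi>))\<^sup>2
      \<le> real (card (class_group_torsion l d)) * (real (card ?I) * real (card E))"
    by (intro mult_left_mono) auto
  also have "\<dots> = real (card (class_group_torsion l d) * card ?I) * real (card E)" by simp
  also have "\<dots> \<le> real (card (carrier CG)) * real (card E)"
    using CG.card_torsion_mult_card_powers_le[OF class_number_bound(1), of l]
    unfolding class_group_torsion_def by (intro mult_right_mono) (simp_all only: of_nat_le_iff of_nat_0_le_iff)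
  also have "\<dots> \<le> real (card (carrier CG)) * (real (card ?\<pi>) + 2 * real (card ?S))"
    using E by (intro mult_left_mono) auto
  finally show ?thesis .
qed

end

theorem theorem4p1:
  shows "\<exists>C::real. C > 0 \<and>
    (\<forall>(l::nat) (Z::real) (d::int).
       Factorial_Ring.prime l \<longrightarrow> Z > 0 \<longrightarrow> squarefree d \<longrightarrow> d < -1 \<longrightarrow>
       card (degree_one_primes d Z) > 0 \<longrightarrow>
       real (card (class_group_torsion l d)) \<le>
         C * sqrt \<bar>real_of_int d\<bar> * ln \<bar>real_of_int d\<bar> / real (card (degree_one_primes d Z)) +
         C * sqrt \<bar>real_of_int d\<bar> * ln \<bar>real_of_int d\<bar> / (real (card (degree_one_primes d Z)))\<^sup>2
           * real (card (S_set l d Z)))"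
\<comment> \<open>14 is 7 from the class number bound times 2 from the two pairs per
  generator.\<close>
proof (intro exI[of _ 14] conjI allI impI)
  fix l :: nat and Z :: real and d :: int
  assume l: "Factorial_Ring.prime l" and d: "squarefree d" "d < -1"
    and pos: "card (degree_one_primes d Z) > 0"
  interpret imag_quad d by unfold_locales (use d in auto)
  define n where "n = real (card (degree_one_primes d Z))"
  define s where "s = real (card (S_set l d Z))"
  define h where "h = real (card (carrier (class_group d)))"
  define D where "D = sqrt \<bar>real_of_int d\<bar> * ln \<bar>real_of_int d\<bar>"
  have n: "n > 0" and s: "s \<ge> 0" using pos by (auto simp: n_def s_def)
  have hD: "h \<le> 7 * D" using class_number_bound(2) d(2) by (simp add: h_def D_def)
  have h0: "h \<ge> 0" by (simp add: h_def)
  have "real (card (class_group_torsion l d)) * n\<^sup>2 \<le> h * (n + 2 * s)"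
    unfolding n_def s_def h_def using torsion_bound[OF prime_gt_0_nat[OF l] pos] .
  also have "\<dots> \<le> 7 * D * (n + 2 * s)" using hD n s by (intro mult_right_mono) auto
  \<comment> \<open>Replacing 7 by 14 in the first term uses \<open>D \<ge> 0\<close>, which follows
    from \<open>0 \<le> h \<le> 7 * D\<close>.\<close>
  also have "\<dots> \<le> 14 * D * n + 14 * D * s" using hD h0 n by (simp add: algebra_simps)
  finally have "real (card (class_group_torsion l d)) \<le> (14 * D * n + 14 * D * s) / n\<^sup>2"
    using n by (simp add: pos_le_divide_eq)
  also have "\<dots> = 14 * D / n + 14 * D / n\<^sup>2 * s" using n by (simp add: field_simps power2_eq_square)
  finally show "real (card (class_group_torsion l d)) \<le>
      14 * sqrt \<bar>real_of_int d\<bar> * ln \<bar>real_of_int d\<bar> / real (card (degree_one_primes d Z)) +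
      14 * sqrt \<bar>real_of_int d\<bar> * ln \<bar>real_of_int d\<bar> / (real (card (degree_one_primes d Z)))\<^sup>2
        * real (card (S_set l d Z))"
    by (simp add: D_def n_def s_def mult.assoc)
qed simp

end
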